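(* If a finite reflexive digraph $\mathbb{G}$ triangulates a 1-sphere, then $\mathbb{G}$ is S\l upecki.
   Context: A digraph is a finite non-empty set with a binary relation; all digraphs are reflexive. $\mathbb{G}^k$ is the $k$-fold product digraph; a $k$-ary polymorphism is a homomorphism $\mathbb{G}^k\to\mathbb{G}$; it is essentially unary if it equals $g(x_i)$ for some $i$ and some homomorphism $g:\mathbb{G}\to\mathbb{G}$. $\mathbb{G}$ is S\l upecki if for every $k\geq2$ every surjective $k$-ary polymorphism is essentially unary. The simplicial complex $K(\mathbb{G})$ has as simplices those subsets of vertices that are the image of a homomorphism from a finite totally ordered set (viewed as a reflexive digraph) to $\mathbb{G}$; $\mathbb{G}$ triangulates $X$ if $X$ is homeomorphic to the geometric realisation of $K(\mathbb{G})$. *)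

theory Defs
  imports "HOL-Analysis.Analysis"
begin

record 'a digraph =
  verts :: "'a set"
  arcs :: "'a rel"

definition finite_digraph :: "'a digraph \<Rightarrow> bool" where
  "finite_digraph G \<longleftrightarrow>
     finite (verts G) \<and> verts G \<noteq> {} \<and> arcs G \<subseteq> verts G \<times> verts G"

definition reflexive_digraph :: "'a digraph \<Rightarrow> bool" where
  "reflexive_digraph G \<longleftrightarrow> refl_on (verts G) (arcs G)"

definition digraph_hom :: "'a digraph \<Rightarrow> 'b digraph \<Rightarrow> ('a \<Rightarrow> 'b) set" where
  "digraph_hom G H =
     {f. f \<in> verts G \<rightarrow> verts H \<and> (\<forall>(x, y) \<in> arcs G. (f x, f y) \<in> arcs H)}"

definition power_digraph :: "'a digraph \<Rightarrow> nat \<Rightarrow> (nat \<Rightarrow> 'a) digraph" where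
  "power_digraph G k =
     \<lparr> verts = {..<k} \<rightarrow>\<^sub>E verts G,
       arcs = {(x, y). x \<in> {..<k} \<rightarrow>\<^sub>E verts G \<and> y \<in> {..<k} \<rightarrow>\<^sub>E verts G \<and>
                       (\<forall>i<k. (x i, y i) \<in> arcs G)} \<rparr>"

definition polymorphism :: "'a digraph \<Rightarrow> nat \<Rightarrow> ((nat \<Rightarrow> 'a) \<Rightarrow> 'a) \<Rightarrow> bool" where
  "polymorphism G k f \<longleftrightarrow> f \<in> digraph_hom (power_digraph G k) G"

definition essentially_unary :: "'a digraph \<Rightarrow> nat \<Rightarrow> ((nat \<Rightarrow> 'a) \<Rightarrow> 'a) \<Rightarrow> bool" where
  "essentially_unary G k f \<longleftrightarrow>
     (\<exists>i<k. \<exists>g \<in> digraph_hom G G. \<forall>x \<in> verts (power_digraph G k). f x = g (x i))"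

definition slupecki :: "'a digraph \<Rightarrow> bool" where
  "slupecki G \<longleftrightarrow>
     (\<forall>k\<ge>2. \<forall>f. polymorphism G k f \<and> f ` verts (power_digraph G k) = verts G
        \<longrightarrow> essentially_unary G k f)"

text \<open>
  Every finite totally ordered set is isomorphic to one whose elements are natural numbers, so
  letting the carrier \<open>A\<close> range over sets of naturals is no restriction. The case \<open>A = {}\<close> makes the
  empty set a simplex; it contributes no point to the geometric realisation.
\<close>

definition digraph_complex :: "'a digraph \<Rightarrow> 'a set set" where
  "digraph_complex G =
     {h ` A | h (A :: nat set) r.
        finite A \<and> linear_order_on A r \<and> h \<in> digraph_hom \<lparr> verts = A, arcs = r \<rparr> G}"

text \<open>
  Points are given by barycentric coordinates, extended by \<open>0\<close> outside the vertex set. On a complex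
  with finitely many vertices the topology of pointwise convergence is the usual one (it is in
  general coarser than the weak topology on an infinite complex).
\<close>

definition geometric_realisation :: "'a set set \<Rightarrow> ('a \<Rightarrow> real) topology" where
  "geometric_realisation K =
     subtopology (powertop_real UNIV)
       {t. (\<forall>v. 0 \<le> t v) \<and> {v. t v \<noteq> 0} \<in> K \<and> (\<Sum>v | t v \<noteq> 0. t v) = 1}"

definition triangulates :: "'a digraph \<Rightarrow> 'b topology \<Rightarrow> bool" where
  "triangulates G X \<longleftrightarrow> X homeomorphic_space geometric_realisation (digraph_complex G)"

end

theory Submission
  imports Defs
begin

text \<open>
  A circle is disconnected by any two of its points but by no single one. Applied to points in the
  realisation, this shows that no three distinct vertices form a transitive triangle, that every
  vertex has exactly two neighbours and that the graph is connected: \<open>G\<close> is a cycle of length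
  \<open>n \<ge> 3\<close> with some orientation, possibly two-way, of each edge.

  Let \<open>f\<close> be a \<open>k\<close>-ary polymorphism. If, for some choice of the other arguments, \<open>f\<close> maps one argument
  onto \<open>G\<close>, then this unary map is an automorphism, and an automorphism of \<open>G\<close> is isolated among the
  endomorphisms; hence the map does not depend on the choice and \<open>f\<close> is essentially unary.

  Otherwise every such unary map misses a vertex and therefore lifts to the universal cover of the
  cycle, the integers. As transitive triangles are degenerate, these lifts fit together to a lift
  \<open>F\<close> of \<open>f\<close>. Call an edge strict if it is one-way. When all arguments move by at most one, \<open>F\<close> moves
  by at most two, and by at most one if it has to cross a strict edge. Any two \<open>k\<close>-tuples of
  vertices are at most \<open>n div 2\<close> such moves apart, so if \<open>F\<close> took \<open>n\<close> consecutive values, at most one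
  edge between these would be strict; the two remaining cases are excluded directly. So \<open>F\<close> takes fewer than \<open>n\<close>
  values and \<open>f\<close> is not surjective.
\<close>

section \<open>Periodic homomorphisms on the integer lattice\<close>

text \<open>\<open>E\<close> stands for the arcs of the cycle lifted to the integers,
  \<open>F\<close> for a lift of the polymorphism. \<open>F_per\<close> says that \<open>F\<close>
  depends only on residues modulo \<open>n\<close>, that is, on vertices; so \<open>F\<close> does
  not wind around the cycle.\<close>

locale periodic_hom =
  fixes E :: "int \<Rightarrow> int \<Rightarrow> bool" and n :: int and k :: nat and F :: "(nat \<Rightarrow> int) \<Rightarrow> int"
  assumes n3: "n \<ge> 3"
    and E_refl: "E a a"
    and E_close: "E a b \<Longrightarrow> \<bar>a - b\<bar> \<le> 1"
    and E_edge: "E a (a + 1) \<or> E (a + 1) a"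
    and F_hom: "(\<And>i. i < k \<Longrightarrow> E (x i) (y i)) \<Longrightarrow> E (F x) (F y)"
    and F_per: "(\<And>i. i < k \<Longrightarrow> n dvd x i - y i) \<Longrightarrow> F x = F y"
begin

definition strict :: "int \<Rightarrow> bool" where
  "strict a \<longleftrightarrow> \<not> (E a (a + 1) \<and> E (a + 1) a)"

lemma not_strictD: "\<not> strict a \<Longrightarrow> E a (a + 1)" "\<not> strict a \<Longrightarrow> E (a + 1) a"
  by (auto simp: strict_def)

lemma F_cong: "(\<And>i. i < k \<Longrightarrow> x i = y i) \<Longrightarrow> F x = F y"
  by (rule F_per) simp

text \<open>\<open>F_per\<close> permits any representatives modulo \<open>n\<close>. The choice of
  the window later decides how long a walk between two tuples is and which edges it crosses.\<close>

lemma residue_in_window: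
  obtains y' where "F y' = F y" "\<And>i. m i \<le> y' i \<and> y' i < m i + n"
proof
  let ?y = "\<lambda>i. m i + (y i - m i) mod n"
  show "F ?y = F y"
  proof (rule F_per)
    fix i
    have "?y i - y i = - (n * ((y i - m i) div n))"
      using mult_div_mod_eq[of n "y i - m i"] by linarith
    then show "n dvd ?y i - y i" by simp
  qed
  show "m i \<le> ?y i \<and> ?y i < m i + n" for i
    using n3 by simp
qed

text \<open>All coordinates move towards their targets at once, one unit per step, and wait after
  arrival. So \<open>d\<close> steps suffice and only edges between \<open>x i\<close> and
  \<open>y i\<close> are crossed. The invariant \<open>Q\<close> may depend on the number of
  steps.\<close>

lemma walk_induct:
  assumes Srefl: "\<And>a. S a a"
    and up: "\<And>i a. i < k \<Longrightarrow> x i \<le> a \<Longrightarrow> a < y i \<Longrightarrow> S a (a + 1)"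
    and down: "\<And>i a. i < k \<Longrightarrow> y i \<le> a \<Longrightarrow> a < x i \<Longrightarrow> S (a + 1) a"
    and dist: "\<And>i. i < k \<Longrightarrow> \<bar>x i - y i\<bar> \<le> int d"
    and base: "Q 0 (F x)"
    and step: "\<And>t u v. Q t (F u) \<Longrightarrow> (\<And>i. i < k \<Longrightarrow> S (u i) (v i)) \<Longrightarrow> Q (Suc t) (F v)"
  shows "Q d (F y)"
proof -
  define w :: "nat \<Rightarrow> nat \<Rightarrow> int" where
    "w = (\<lambda>t i. if x i \<le> y i then min (x i + int t) (y i) else max (x i - int t) (y i))"
  have "Q t (F (w t))" for t
  proof (induction t)
    case 0
    have "F (w 0) = F x" by (rule F_cong) (simp add: w_def)
    then show ?case using base by simp
  next
    case (Suc t)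
    have "S (w t i) (w (Suc t) i)" if i: "i < k" for i
    proof -
      consider (lt) "x i + int t < y i" | (gt) "y i < x i - int t"
        | (eq) "x i + int t \<ge> y i" "y i \<ge> x i - int t" by linarith
      then show ?thesis
      proof cases
        case lt
        then have "w t i = x i + int t" "w (Suc t) i = x i + int t + 1" by (auto simp: w_def)
        then show ?thesis using up[OF i, of "x i + int t"] lt by simp
      next
        case gt
        then have "w t i = (x i - int t - 1) + 1" "w (Suc t) i = x i - int t - 1"
          by (auto simp: w_def)
        then show ?thesis using down[OF i, of "x i - int t - 1"] gt by simp
      next
        case eq
        then have "w t i = y i" "w (Suc t) i = y i" by (auto simp: w_def)
        then show ?thesis using Srefl by simp
      qed
    qed
    then show ?case by (rule step[OF Suc])
  qed
  moreover have "F (w d) = F y"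
    by (rule F_cong) (use dist in \<open>force simp: w_def\<close>)
  ultimately show ?thesis by metis
qed

text \<open>A tuple of common out-neighbours, chosen coordinatewise, is mapped by \<open>F\<close>
  to a common out-neighbour; by \<open>E_close\<close> the two values then differ by at most
  two.\<close>

lemma common_neighbours_close:
  assumes "\<And>i. i < k \<Longrightarrow> \<exists>z. E (x i) z \<and> E (y i) z"
  obtains z where "E (F x) z" "E (F y) z"
proof -
  from assms obtain z where z: "\<And>i. i < k \<Longrightarrow> E (x i) (z i) \<and> E (y i) (z i)" by metis
  then have "E (F x) (F z)" "E (F y) (F z)" by (auto intro!: F_hom)
  then show ?thesis by (rule that)
qed

lemma common_neighbours_close':
  assumes "\<And>i. i < k \<Longrightarrow> \<exists>z. E z (x i) \<and> E z (y i)"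
  obtains z where "E z (F x)" "E z (F y)"
proof -
  from assms obtain z where z: "\<And>i. i < k \<Longrightarrow> E (z i) (x i) \<and> E (z i) (y i)" by metis
  then have "E (F z) (F x)" "E (F z) (F y)" by (auto intro!: F_hom)
  then show ?thesis by (rule that)
qed

text \<open>Of two consecutive integers, the head of an arc between them is a common out-neighbour
  and the tail a common in-neighbour, because loops are arcs.\<close>

lemma common_neighbour:
  assumes "\<bar>a - b\<bar> \<le> 1"
  shows "\<exists>z. E a z \<and> E b z" "\<exists>z. E z a \<and> E z b"
proof -
  have "a = b \<or> b = a + 1 \<or> a = b + 1" using assms by linarith
  then show "\<exists>z. E a z \<and> E b z" "\<exists>z. E z a \<and> E z b"
    using E_edge E_refl by metis+
qed

text \<open>Moving every coordinate by at most one is a forward step followed by a backward one, and also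
  a backward step followed by a forward one. So \<open>F\<close> can rise by two only across two edges that
  are bidirectional.\<close>

lemma sup_step:
  assumes "\<And>i. i < k \<Longrightarrow> \<bar>x i - y i\<bar> \<le> 1"
  shows "F y \<le> F x + 1 \<or> F y = F x + 2 \<and> \<not> strict (F x) \<and> \<not> strict (F x + 1)"
proof -
  obtain z where z: "E (F x) z" "E (F y) z"
    using common_neighbours_close common_neighbour(1) assms by metis
  obtain z' where z': "E z' (F x)" "E z' (F y)"
    using common_neighbours_close' common_neighbour(2) assms by metis
  show ?thesis
  proof (cases "F y \<le> F x + 1")
    case False
    then have "F y = F x + 2" "z = F x + 1" "z' = F x + 1"
      using E_close[OF z(1)] E_close[OF z(2)] E_close[OF z'(1)] E_close[OF z'(2)] by linarith+
    then show ?thesis using z z' by (auto simp: strict_def add.assoc)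
  qed simp
qed

section \<open>Bounds on the number of values of a periodic homomorphism\<close>

text \<open>Count each of two strict edges twice. A move of all coordinates by at most one raises
  this count by at most two, since by \<open>sup_step\<close> a rise by two crosses no strict edge.
  All residues are within \<open>n div 2\<close> moves, so the count rises by at most
  \<open>n\<close>; but reaching \<open>F y\<close> takes \<open>n + 1\<close>.\<close>

lemma strict_unique:
  assumes win: "F y \<ge> F x + n - 1"
    and a: "F x \<le> a" "a < F x + n - 1" "strict a"
    and b: "F x \<le> b" "b < F x + n - 1" "strict b"
  shows "a = b"
proof (rule ccontr)
  assume "a \<noteq> b"
  \<comment> \<open>\<open>\<phi>\<close> is the position on the line after the edges at
    \<open>a\<close> and \<open>b\<close> have been stretched to length two.\<close>
  define \<phi> :: "int \<Rightarrow> int" where "\<phi> = (\<lambda>u. u + (if u > a then 1 else 0) + (if u > b then 1 else 0))"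
  \<comment> \<open>The windows are centred at \<open>x i\<close>, which keeps every coordinate
    within \<open>n div 2\<close> of its start.\<close>
  obtain y' where y': "F y' = F y" "\<And>i. x i - n div 2 \<le> y' i \<and> y' i < x i - n div 2 + n"
    using residue_in_window[of y "\<lambda>i. x i - n div 2"] by blast
  have "\<phi> (F y') \<le> \<phi> (F x) + 2 * int (nat (n div 2))"
  proof (rule walk_induct[where S = "\<lambda>a b. \<bar>a - b\<bar> \<le> 1"
        and Q = "\<lambda>t u. \<phi> u \<le> \<phi> (F x) + 2 * int t" and x = x])
    fix i
    have "n - 1 - n div 2 \<le> n div 2" by linarith
    then show "\<bar>x i - y' i\<bar> \<le> int (nat (n div 2))"
      using y'(2)[of i] n3 by linarith
  next
    fix t u v
    assume t: "\<phi> (F u) \<le> \<phi> (F x) + 2 * int t" and uv: "\<And>i. i < k \<Longrightarrow> \<bar>u i - v i\<bar> \<le> 1"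
    have "\<phi> (F v) \<le> \<phi> (F u) + 2"
      using sup_step[of u v, OF uv]
    proof
      assume "F v \<le> F u + 1"
      then show ?thesis using \<open>a \<noteq> b\<close> by (auto simp: \<phi>_def)
    next
      assume "F v = F u + 2 \<and> \<not> strict (F u) \<and> \<not> strict (F u + 1)"
      moreover from this have "a \<noteq> F u" "a \<noteq> F u + 1" "b \<noteq> F u" "b \<noteq> F u + 1"
        using a b by metis+
      ultimately show ?thesis by (auto simp: \<phi>_def)
    qed
    then show "\<phi> (F v) \<le> \<phi> (F x) + 2 * int (Suc t)" using t by simp
  qed auto
  moreover have "\<phi> (F x) = F x" using a b by (simp add: \<phi>_def)
  moreover have "\<phi> (F y') \<ge> F x + n - 1 + 2" using a b win y'(1) by (simp add: \<phi>_def)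
  ultimately show False using n3 by linarith
qed

text \<open>A first double step, through common out-neighbours, costs at most two. Distance
  \<open>n - 1\<close> is avoided by going round the cycle, so at most \<open>n - 4\<close> steps
  along arcs remain, each costing at most one.\<close>

lemma no_strict_bound:
  assumes n4: "n \<ge> 4"
    and ns: "\<And>a. F x \<le> a \<Longrightarrow> a < F x + n - 1 \<Longrightarrow> \<not> strict a"
  shows "F y \<le> F x + n - 2"
proof -
  define p where "p = F x"
  obtain u where u: "F u = F x" "\<And>i. p \<le> u i \<and> u i < p + n"
    using residue_in_window[of x "\<lambda>_. p"] by blast
  obtain v where v: "F v = F y" "\<And>i. p \<le> v i \<and> v i < p + n"
    using residue_in_window[of y "\<lambda>_. p"] by blast
  have bi: "E a (a + 1)" "E (a + 1) a" if "p \<le> a" "a < p + n - 1" for a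
    using ns[of a] that not_strictD p_def by auto
  text \<open>Within two steps a coordinate that has to move from one end of the window to the other
    crosses the possibly one-way edge that closes the cycle; the others advance by two.\<close>
  define w :: "nat \<Rightarrow> int" where "w = (\<lambda>i.
      if v i - u i = n - 1 then u i - 1 else if u i - v i = n - 1 then u i + 1
      else if u i \<le> v i then min (u i + 2) (v i) else max (u i - 2) (v i))"
  \<comment> \<open>Where the walk goes round, the target is moved by \<open>n\<close>, so that
    \<open>w\<close> has already reached it.\<close>
  define v' where "v' = (\<lambda>i. if \<bar>u i - v i\<bar> = n - 1 then w i else v i)"
  have "F v' = F v"
    by (rule F_per) (auto simp: v'_def w_def abs_if dvd_def intro: exI[of _ "-1"] exI[of _ "1"])
  \<comment> \<open>At distance two the midpoint serves, since both edges lie inside the window and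
    are two-way.\<close>
  have "\<exists>z. E (u i) z \<and> E (w i) z" for i
  proof (cases "\<bar>u i - w i\<bar> \<le> 1")
    case True
    then show ?thesis by (rule common_neighbour)
  next
    case False
    then consider "w i = u i + 2" "u i + 2 \<le> v i" | "w i = u i - 2" "v i \<le> u i - 2"
      by (auto simp: w_def min_def max_def split: if_splits)
    then show ?thesis
    proof cases
      case 1
      then show ?thesis using bi[of "u i"] bi[of "u i + 1"] u(2)[of i] v(2)[of i]
        by (intro exI[of _ "u i + 1"]) (auto simp: add.assoc)
    next
      case 2
      then show ?thesis using bi[of "u i - 1"] bi[of "u i - 2"] u(2)[of i] v(2)[of i]
        by (intro exI[of _ "u i - 1"]) auto
    qed
  qed
  then obtain z where "E (F u) z" "E (F w) z"
    using common_neighbours_close by metis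
  then have "F w \<le> p + 2"
    using E_close[of "F u" z] E_close[of "F w" z] u(1) p_def by linarith
  moreover have "F v' \<le> F w + int (nat (n - 4))"
  proof (rule walk_induct[where S = E and Q = "\<lambda>t r. r \<le> F w + int t" and x = w])
    fix i a assume "w i \<le> a" "a < v' i"
    then have "p \<le> a" "a < p + n - 1"
      using u(2)[of i] v(2)[of i] by (auto simp: v'_def w_def min_def max_def split: if_splits)
    then show "E a (a + 1)" using bi by blast
  next
    fix i a assume "v' i \<le> a" "a < w i"
    then have "p \<le> a" "a < p + n - 1"
      using u(2)[of i] v(2)[of i] by (auto simp: v'_def w_def min_def max_def split: if_splits)
    then show "E (a + 1) a" using bi by blast
  next
    fix i
    have "\<bar>w i - v' i\<bar> \<le> n - 4"
      using u(2)[of i] v(2)[of i] n4 by (auto simp: v'_def w_def min_def max_def abs_if split: if_splits)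
    then show "\<bar>w i - v' i\<bar> \<le> int (nat (n - 4))" using n4 by simp
  next
    fix t u v assume "F u \<le> F w + int t" "\<And>i. i < k \<Longrightarrow> E (u i) (v i)"
    then show "F v \<le> F w + int (Suc t)" using F_hom[of u v] E_close by force
  qed (auto simp: E_refl)
  ultimately show ?thesis using \<open>F v' = F v\<close> v(1) n4 p_def by simp
qed

text \<open>The strict edge acts as a valve: values of \<open>F\<close> can pass from
  \<open>e\<close> to \<open>e + 1\<close> along arcs but not against them. Walks that respect this
  direction keep \<open>F\<close> on one side, or leave too few steps for the full rise.\<close>

lemma one_strict_bound:
  assumes fwd: "\<not> E (e + 1) e"
    and e: "F x \<le> e" "e < F x + n - 1"
    and ns: "\<And>a. F x \<le> a \<Longrightarrow> a < F x + n - 1 \<Longrightarrow> a \<noteq> e \<Longrightarrow> \<not> strict a"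
  shows "F y \<le> F x + n - 2"
proof (rule ccontr)
  assume "\<not> F y \<le> F x + n - 2"
  then have big: "F y \<ge> F x + n - 1" by simp
  define p where "p = F x"
  note pe = e[folded p_def]
  have Ee: "E e (e + 1)" using fwd E_edge by blast
  have bi: "E a (a + 1)" "E (a + 1) a" if "p \<le> a" "a < p + n - 1" "a \<noteq> e" for a
    using ns[of a] that not_strictD p_def by auto
  have up: "E a (a + 1)" if "p \<le> a" "a < p + n - 1" for a
    using bi[of a] Ee that by blast
  \<comment> \<open>Going against an arc from at most \<open>e\<close> to above \<open>e\<close>
    would need the missing arc from \<open>e + 1\<close> to \<open>e\<close>.\<close>
  have pred_closed: "F v \<le> e" if "F u \<le> e" "\<And>i. i < k \<Longrightarrow> E (v i) (u i)" for u v
  proof (rule ccontr)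
    assume "\<not> F v \<le> e"
    moreover have "E (F v) (F u)" using that(2) by (rule F_hom)
    ultimately have "F v = e + 1" "F u = e" using E_close that(1) by force+
    then show False using \<open>E (F v) (F u)\<close> fwd by simp
  qed
  \<comment> \<open>A representative of \<open>x\<close> in the window has value \<open>p\<close>.
    From it the walk to \<open>v\<close> can be made against arcs: descents because every edge in
    the window has a forward arc, ascents because they stay below the strict edge.\<close>
  have low: "F v \<le> e" if v: "\<And>i. i < k \<Longrightarrow> p \<le> v i \<and> v i \<le> e" for v
  proof -
    obtain u where u: "F u = F x" "\<And>i. p \<le> u i \<and> u i < p + n"
      using residue_in_window[of x "\<lambda>_. p"] by blast
    show ?thesis
    proof (rule walk_induct[where S = "\<lambda>a b. E b a" and Q = "\<lambda>_ r. r \<le> e" and x = u and d = "nat n"])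
      fix i a assume "i < k" "u i \<le> a" "a < v i"
      then show "E (a + 1) a" using bi[of a] v[of i] u(2)[of i] pe by simp
    next
      fix i a assume "i < k" "v i \<le> a" "a < u i"
      then show "E a (a + 1)" using up[of a] v[of i] u(2)[of i] pe by simp
    next
      fix i assume "i < k"
      then show "\<bar>u i - v i\<bar> \<le> int (nat n)" using v[of i] u(2)[of i] pe n3 by linarith
    qed (use u(1) e pred_closed E_refl in auto)
  qed
  show False
  \<comment> \<open>If the closing edge has a forward arc, then every descent from the constant
    tuple at \<open>p + n\<close> goes against arcs. That tuple has the same value as the one at
    \<open>p\<close>, so \<open>F\<close> never exceeds \<open>e\<close>.\<close>
  proof (cases "E (p + n - 1) (p + n)")
    case True
    have up': "E a (a + 1)" if "p \<le> a" "a < p + n" for a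
      using up[of a] True that by (cases "a = p + n - 1") auto
    obtain v where v: "F v = F y" "\<And>i. p \<le> v i \<and> v i < p + n"
      using residue_in_window[of y "\<lambda>_. p"] by blast
    have "F (\<lambda>_. p + n) = F (\<lambda>_. p)" by (rule F_per) simp
    have "F v \<le> e"
    proof (rule walk_induct[where S = "\<lambda>a b. E b a" and Q = "\<lambda>_ r. r \<le> e"
          and x = "\<lambda>_. p + n" and d = "nat n"])
      fix i a assume "i < k" "v i \<le> a" "a < p + n"
      then show "E a (a + 1)" using up'[of a] v(2)[of i] by simp
    next
      fix i a assume "p + n \<le> a" "a < v i"
      then show "E (a + 1) a" using v(2)[of i] by simp
    next
      fix i show "\<bar>p + n - v i\<bar> \<le> int (nat n)" using v(2)[of i] n3 by linarith
    next
      show "F (\<lambda>_. p + n) \<le> e"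
        unfolding \<open>F (\<lambda>_. p + n) = F (\<lambda>_. p)\<close> by (rule low) (use pe in auto)
    qed (use pred_closed E_refl in auto)
    then show False using v(1) big e by simp
  next
    case False
    then have close: "E (p + n) (p + n - 1)" using E_edge[of "p + n - 1"] by auto
    show False
    proof (cases "e = p + n - 2")
      case False
      then have e2: "e \<le> p + n - 3" using pe by simp
      obtain v where v: "F v = F y" "\<And>i. p \<le> v i \<and> v i < p + n"
        using residue_in_window[of y "\<lambda>_. p"] by blast
      \<comment> \<open>Modulo \<open>n\<close> the tuple \<open>u\<close> is low. It reaches
        \<open>v\<close> along arcs in at most \<open>p + n - 2 - e\<close> steps, because a
        coordinate \<open>p + n - 1\<close> is entered from \<open>p + n\<close> over the closing
        edge instead of climbing from \<open>e\<close>.\<close>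
      define u where "u = (\<lambda>i. if v i \<le> e then v i else if v i = p + n - 1 then p + n else e)"
      have "F u = F (\<lambda>i. if v i = p + n - 1 then p else u i)"
        by (rule F_per) (use e2 in \<open>auto simp: u_def\<close>)
      also have "\<dots> \<le> e" by (rule low) (use v(2) e2 pe in \<open>auto simp: u_def\<close>)
      finally have Fu: "F u \<le> e" .
      have "F v \<le> e + int (nat (p + n - 2 - e))"
      proof (rule walk_induct[where S = E and Q = "\<lambda>t r. r \<le> e + int t" and x = u])
        fix i a assume "u i \<le> a" "a < v i"
        then show "E a (a + 1)" using up[of a] v(2)[of i] pe by (auto simp: u_def split: if_splits)
      next
        fix i a assume "v i \<le> a" "a < u i"
        then have "a = p + n - 1" using v(2)[of i] by (auto simp: u_def split: if_splits)
        then show "E (a + 1) a" using close by simp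
      next
        fix i show "\<bar>u i - v i\<bar> \<le> int (nat (p + n - 2 - e))"
          using v(2)[of i] e2 by (auto simp: u_def)
      next
        fix t u v assume "F u \<le> e + int t" "\<And>i. i < k \<Longrightarrow> E (u i) (v i)"
        then show "F v \<le> e + int (Suc t)" using F_hom[of u v] E_close by force
      qed (use Fu E_refl in auto)
      then show False using v(1) big e2 p_def by simp
    next
      case True
      obtain v where v: "F v = F y" "\<And>i. p \<le> v i \<and> v i < p + n"
        using residue_in_window[of y "\<lambda>_. p"] by blast
      \<comment> \<open>Now the strict edge ends at \<open>p + n - 1\<close>, so values of at least
        \<open>p + n - 1\<close> persist along arcs, and the constant top tuple has such a value.
        From there a representative of \<open>x\<close> is at most \<open>n - 2\<close> steps away
        against arcs, too few to descend to \<open>p\<close>.\<close>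
      have top: "F (\<lambda>_. p + n - 1) \<ge> p + n - 1"
      proof (rule walk_induct[where S = E and Q = "\<lambda>_ r. r \<ge> p + n - 1" and x = v and d = "nat n"])
        fix i a assume "v i \<le> a" "a < p + n - 1"
        then show "E a (a + 1)" using up[of a] v(2)[of i] by simp
      next
        fix i a assume "p + n - 1 \<le> a" "a < v i"
        then show "E (a + 1) a" using v(2)[of i] by simp
      next
        fix i show "\<bar>v i - (p + n - 1)\<bar> \<le> int (nat n)" using v(2)[of i] n3 by linarith
      next
        show "p + n - 1 \<le> F v" using v(1) big p_def by simp
      next
        fix u v assume u: "p + n - 1 \<le> F u" and uv: "\<And>i. i < k \<Longrightarrow> E (u i) (v i)"
        show "p + n - 1 \<le> F v"
        proof (rule ccontr)
          assume "\<not> p + n - 1 \<le> F v"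
          moreover have "E (F u) (F v)" using uv by (rule F_hom)
          ultimately have "F v = e" "F u = e + 1" using E_close u True by force+
          then show False using \<open>E (F u) (F v)\<close> fwd by simp
        qed
      qed (simp add: E_refl)
      obtain u where u: "F u = F x" "\<And>i. p + 1 \<le> u i \<and> u i < p + 1 + n"
        using residue_in_window[of x "\<lambda>_. p + 1"] by blast
      have "F u \<ge> p + n - 1 - int (nat (n - 2))"
      proof (rule walk_induct[where S = "\<lambda>a b. E b a" and Q = "\<lambda>t r. r \<ge> p + n - 1 - int t"
            and x = "\<lambda>_. p + n - 1"])
        fix i a assume "p + n - 1 \<le> a" "a < u i"
        then have "a = p + n - 1" using u(2)[of i] by simp
        then show "E (a + 1) a" using close by simp
      next
        fix i a assume "u i \<le> a" "a < p + n - 1"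
        then show "E a (a + 1)" using up[of a] u(2)[of i] by simp
      next
        fix i show "\<bar>p + n - 1 - u i\<bar> \<le> int (nat (n - 2))" using u(2)[of i] n3 by linarith
      next
        fix t u v assume "p + n - 1 - int t \<le> F u" "\<And>i. i < k \<Longrightarrow> E (v i) (u i)"
        then show "p + n - 1 - int (Suc t) \<le> F v" using F_hom[of v u] E_close by force
      qed (use top E_refl in auto)
      then show False using u(1) p_def n3 by simp
    qed
  qed
qed

lemma converse: "periodic_hom (\<lambda>a b. E b a) n k F"
proof unfold_locales
  show "E b a \<Longrightarrow> \<bar>a - b\<bar> \<le> 1" for a b using E_close[of b a] by simp
qed (use n3 E_refl E_edge F_per F_hom in auto)

text \<open>By \<open>strict_unique\<close> a full rise crosses at most one strict edge; if that
  edge points backwards, all arcs are reversed. For \<open>n = 3\<close> a full rise crosses two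
  consecutive edges, and \<open>no_tri\<close> makes one of them strict.\<close>

lemma oscillation_bound:
  assumes no_tri: "\<And>a. n = 3 \<Longrightarrow> strict a \<or> strict (a + 1)"
  shows "F y \<le> F x + n - 2"
proof (rule ccontr)
  assume neg: "\<not> F y \<le> F x + n - 2"
  show False
  proof (cases "\<exists>e. F x \<le> e \<and> e < F x + n - 1 \<and> strict e")
    case True
    then obtain e where e: "F x \<le> e" "e < F x + n - 1" "strict e" by blast
    have ns: "\<not> strict a" if "F x \<le> a" "a < F x + n - 1" "a \<noteq> e" for a
      using strict_unique[of x y a e] neg that e by auto
    interpret conv: periodic_hom "\<lambda>a b. E b a" n k F by (rule converse)
    have "conv.strict a = strict a" for a unfolding strict_def conv.strict_def by blast
    then show False
      using one_strict_bound[of e x y] conv.one_strict_bound[of e x y] e ns neg E_edge[of e]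
      unfolding strict_def by auto
  next
    case False
    then have "n \<noteq> 3" using no_tri[of "F x"] by auto
    then show False using no_strict_bound[of x y] neg False n3 by force
  qed
qed

end

section \<open>Oriented cycles\<close>

definition adjacent :: "'a rel \<Rightarrow> 'a \<Rightarrow> 'a \<Rightarrow> bool" where
  "adjacent A x y \<longleftrightarrow> x \<noteq> y \<and> ((x, y) \<in> A \<or> (y, x) \<in> A)"

lemma adjacent_sym: "adjacent A x y \<Longrightarrow> adjacent A y x"
  by (auto simp: adjacent_def)

text \<open>The combinatorial content of triangulating a circle: a finite connected graph in which
  every vertex has two neighbours is a cycle, and a cycle of length three must not be transitively
  oriented.\<close>

locale circle_digraph =
  fixes V :: "'a set" and A :: "'a rel"
  assumes finite_V: "finite V"
    and V_nonempty: "V \<noteq> {}"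
    and A_sub: "A \<subseteq> V \<times> V"
    and A_refl: "v \<in> V \<Longrightarrow> (v, v) \<in> A"
    and no_transitive_triangle: "(a, b) \<in> A \<Longrightarrow> (b, c) \<in> A \<Longrightarrow> (a, c) \<in> A \<Longrightarrow> a = b \<or> b = c \<or> a = c"
    and two_neighbours: "v \<in> V \<Longrightarrow> \<exists>a b. a \<noteq> b \<and> {w. adjacent A v w} = {a, b}"
    and connected: "S \<subseteq> V \<Longrightarrow> S \<noteq> {} \<Longrightarrow> S \<noteq> V \<Longrightarrow> \<exists>x\<in>S. \<exists>y\<in>V - S. adjacent A x y"
begin

lemma adjacent_in_V: "adjacent A x y \<Longrightarrow> x \<in> V \<and> y \<in> V"
  using A_sub by (auto simp: adjacent_def)

lemma neighbours_eq:
  assumes "adjacent A v x" "adjacent A v y" "x \<noteq> y"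
  shows "{w. adjacent A v w} = {x, y}"
proof -
  obtain a b where ab: "{w. adjacent A v w} = {a, b}"
    using two_neighbours adjacent_in_V assms(1) by meson
  then have "x \<in> {a, b}" "y \<in> {a, b}" using assms by (metis mem_Collect_eq)+
  then show ?thesis unfolding ab using assms(3) by auto
qed

lemma connected_induct [consumes 2, case_names base step]:
  assumes "v \<in> V" "w \<in> V" "P v" "\<And>x y. P x \<Longrightarrow> adjacent A x y \<Longrightarrow> P y"
  shows "P w"
  using connected[of "{x \<in> V. P x}"] assms by auto

lemma converse: "circle_digraph V (A\<inverse>)"
proof -
  have "adjacent (A\<inverse>) = adjacent A" by (auto simp: adjacent_def fun_eq_iff)
  then show ?thesis
    using finite_V V_nonempty A_sub A_refl no_transitive_triangle two_neighbours connected
    by unfold_locales (simp_all, blast+)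
qed

section \<open>Unrolling the cycle onto the integers\<close>

text \<open>A vertex entered from one neighbour is left through the other. The choice is made on
  pairs of consecutive vertices, as the next vertex depends on the last two.\<close>

lemma nonbacktracking_ray:
  assumes "adjacent A v a"
  obtains r :: "nat \<Rightarrow> 'a" where "r 0 = v" "r 1 = a"
    "\<And>m. adjacent A (r m) (r (Suc m))" "\<And>m. r (Suc (Suc m)) \<noteq> r m"
proof -
  have "\<exists>f. \<forall>m. (adjacent A (fst (f m)) (snd (f m)) \<and> (m = 0 \<longrightarrow> f m = (v, a)))
      \<and> (fst (f (Suc m)) = snd (f m) \<and> snd (f (Suc m)) \<noteq> fst (f m))"
  proof (rule dependent_nat_choice)
    show "\<exists>x. adjacent A (fst x) (snd x) \<and> ((0::nat) = 0 \<longrightarrow> x = (v, a))" using assms by auto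
  next
    fix x :: "'a \<times> 'a" and m :: nat
    assume "adjacent A (fst x) (snd x) \<and> (m = 0 \<longrightarrow> x = (v, a))"
    then have "snd x \<in> V" using adjacent_in_V by blast
    then obtain d e where "d \<noteq> e" "{w. adjacent A (snd x) w} = {d, e}"
      using two_neighbours by blast
    then obtain w where "w \<noteq> fst x" "adjacent A (snd x) w" by (metis insertCI mem_Collect_eq)
    then show "\<exists>y. (adjacent A (fst y) (snd y) \<and> (Suc m = 0 \<longrightarrow> y = (v, a)))
        \<and> fst y = snd x \<and> snd y \<noteq> fst x"
      by (intro exI[of _ "(snd x, w)"]) auto
  qed
  then obtain f where f: "\<And>m. adjacent A (fst (f m)) (snd (f m))" "f 0 = (v, a)"
    "\<And>m. fst (f (Suc m)) = snd (f m)" "\<And>m. snd (f (Suc m)) \<noteq> fst (f m)" by metis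
  show ?thesis
  proof
    show "fst (f 0) = v" "fst (f 1) = a" using f(2) f(3)[of 0] by auto
    show "adjacent A (fst (f m)) (fst (f (Suc m)))" for m using f(1)[of m] f(3)[of m] by simp
    show "fst (f (Suc (Suc m))) \<noteq> fst (f m)" for m using f(3)[of "Suc m"] f(4)[of m] by simp
  qed
qed

text \<open>Two rays leave a vertex through its two neighbours; these differ, so the glued line does
  not backtrack at the origin either.\<close>

lemma nonbacktracking_line:
  obtains c :: "int \<Rightarrow> 'a" where
    "\<And>i. adjacent A (c i) (c (i + 1))" "\<And>i. c (i + 1) \<noteq> c (i - 1)"
proof -
  obtain v where "v \<in> V" using V_nonempty by blast
  then obtain a b where ab: "a \<noteq> b" "{w. adjacent A v w} = {a, b}" using two_neighbours by blast
  then have "adjacent A v a" "adjacent A v b" by blast+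
  from this(1) obtain r where r: "r 0 = v" "r 1 = a"
    "\<And>m. adjacent A (r m) (r (Suc m))" "\<And>m. r (Suc (Suc m)) \<noteq> r m"
    by (rule nonbacktracking_ray) blast
  from \<open>adjacent A v b\<close> obtain l where l: "l 0 = v" "l 1 = b"
    "\<And>m. adjacent A (l m) (l (Suc m))" "\<And>m. l (Suc (Suc m)) \<noteq> l m"
    by (rule nonbacktracking_ray) blast
  define c where "c = (\<lambda>i::int. if i \<ge> 0 then r (nat i) else l (nat (- i)))"
  have cl: "c i = l (nat (- i))" if "i \<le> 0" for i
    using that r(1) l(1) by (auto simp: c_def)
  have cr: "c i = r (nat i)" if "i \<ge> 0" for i using that by (simp add: c_def)
  show ?thesis
  proof
    fix i :: int
    show "adjacent A (c i) (c (i + 1))"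
    proof (cases "i \<ge> 0")
      case True
      then show ?thesis using r(3)[of "nat i"] cr by (simp add: nat_add_distrib)
    next
      case False
      then have "nat (- i) = Suc (nat (- (i + 1)))" by simp
      then show ?thesis using l(3)[of "nat (- (i + 1))"] cl False adjacent_sym by auto
    qed
    consider "i \<ge> 1" | "i = 0" | "i \<le> -1" by linarith
    then show "c (i + 1) \<noteq> c (i - 1)"
    proof cases
      case 1
      then have "nat (i + 1) = Suc (Suc (nat (i - 1)))" by simp
      then show ?thesis using 1 r(4)[of "nat (i - 1)"] cr by simp
    next
      case 2
      then show ?thesis using cl[of "-1"] cr[of 1] r(2) l(2) ab(1) by simp
    next
      case 3
      then have "nat (- (i - 1)) = Suc (Suc (nat (- (i + 1))))" by simp
      then show ?thesis using 3 l(4)[of "nat (- (i + 1))"] cl[of "i + 1"] cl[of "i - 1"] by simp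
    qed
  qed
qed

text \<open>The line hits all vertices by connectedness and repeats by finiteness. A repetition
  fixes the neighbours up to order; once a reversal of the order is excluded, it propagates as a
  translation, and \<open>n\<close> is the least positive period.\<close>

lemma universal_cover:
  obtains c :: "int \<Rightarrow> 'a" and n :: int where
    "n \<ge> 3" "range c = V" "\<And>i j. c i = c j \<longleftrightarrow> n dvd i - j"
    "\<And>i. {w. adjacent A (c i) w} = {c (i - 1), c (i + 1)}"
proof -
  obtain c :: "int \<Rightarrow> 'a" where
    adj: "\<And>i. adjacent A (c i) (c (i + 1))" and nb: "\<And>i. c (i + 1) \<noteq> c (i - 1)"
    by (rule nonbacktracking_line) blast
  have nbrs: "{w. adjacent A (c i) w} = {c (i - 1), c (i + 1)}" for i
    using neighbours_eq[of "c i" "c (i - 1)" "c (i + 1)"] adj[of i] adj[of "i - 1"]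
      adjacent_sym nb[of i] by (metis diff_add_cancel)
  have cV: "c i \<in> V" for i using adj adjacent_in_V by blast
  have ran: "range c = V"
  proof
    show "V \<subseteq> range c"
    proof
      fix w assume "w \<in> V"
      show "w \<in> range c"
      proof (rule connected_induct[of "c 0" w])
        fix x y assume "x \<in> range c" "adjacent A x y"
        then show "y \<in> range c" using nbrs by blast
      qed (use \<open>w \<in> V\<close> cV in auto)
    qed
  qed (use cV in auto)
  \<comment> \<open>A fold would make \<open>c\<close> symmetric under the reflection exchanging
    \<open>i\<close> and \<open>j\<close>. Its centre would be a vertex with two equal neighbours or
    an edge with two equal ends, according to the parity of \<open>j - i\<close>.\<close>
  have no_fold: "c (i + 1) \<noteq> c (j - 1)" if "c i = c j" for i j
  proof
    assume "c (i + 1) = c (j - 1)"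
    have "c (i + int m) = c (j - int m) \<and> c (i + int m + 1) = c (j - int m - 1)
        \<and> c (i - int m) = c (j + int m) \<and> c (i - int m + 1) = c (j + int m - 1)" for m
    proof (induction m)
      case 0
      then show ?case using that \<open>c (i + 1) = c (j - 1)\<close> by simp
    next
      case (Suc m)
      have 1: "{c (i + int m), c (i + int m + 2)} = {c (j - int m - 2), c (j - int m)}"
        using nbrs[of "i + int m + 1"] nbrs[of "j - int m - 1"] Suc by (simp add: algebra_simps)
      have 2: "{c (i - int m - 1), c (i - int m + 1)} = {c (j + int m - 1), c (j + int m + 1)}"
        using nbrs[of "i - int m"] nbrs[of "j + int m"] Suc by simp
      have "c (i + int m + 2) = c (j - int m - 2)"
        using 1 Suc nb[of "i + int m + 1"] by (auto simp: doubleton_eq_iff algebra_simps)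
      moreover have "c (i - int m - 1) = c (j + int m + 1)"
        using 2 Suc nb[of "i - int m"] by (auto simp: doubleton_eq_iff)
      ultimately show ?case using Suc by (simp add: algebra_simps)
    qed
    then have refl: "c (i + m) = c (j - m)" for m
      by (cases m rule: int_cases2) auto
    consider q where "j - i = 2 * q" | q where "j - i = 2 * q + 1"
      by (metis oddE evenE)
    then show False
    proof cases
      case 1
      then have "j - (q + 1) = i + q - 1" by simp
      then show False using refl[of "q + 1"] nb[of "i + q"] by (simp add: algebra_simps)
    next
      case 2
      then have "j - q = i + q + 1" by simp
      then show False using refl[of q] adj[of "i + q"] by (simp add: adjacent_def algebra_simps)
    qed
  qed
  have shift1: "c (i + 1) = c (j + 1)" "c (i - 1) = c (j - 1)" if "c i = c j" for i j
    using nbrs[of i] nbrs[of j] that no_fold[of i j] no_fold[of j i]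
    by (auto simp: doubleton_eq_iff)
  have shift: "c (i + m) = c (j + m)" if "c i = c j" for i j m
  proof (induction m rule: int_induct[of _ 0])
    case (step1 m)
    then show ?case using shift1(1)[of "i + m" "j + m"] by (simp add: add.assoc)
  next
    case (step2 m)
    then show ?case using shift1(2)[of "i + m" "j + m"] by (simp add: algebra_simps)
  qed (use that in simp)
  have "\<not> inj c" using finite_V ran by (metis finite_imageD infinite_UNIV_int)
  then obtain i0 j0 where "c i0 = c j0" "i0 \<noteq> j0" by (auto simp: inj_def)
  define per where "per = (\<lambda>d. d > 0 \<and> c (int d) = c 0)"
  have "\<exists>d. per d"
  proof -
    have "c (i0 - j0) = c 0" "c (j0 - i0) = c 0"
      using shift[OF \<open>c i0 = c j0\<close>, of "- j0"] shift[OF \<open>c i0 = c j0\<close>, of "- i0"] by simp_all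
    then show ?thesis using \<open>i0 \<noteq> j0\<close>
      by (intro exI[of _ "nat \<bar>i0 - j0\<bar>"]) (auto simp: per_def abs_if)
  qed
  define N where "N = (LEAST d. per d)"
  have N: "per N" unfolding N_def using \<open>\<exists>d. per d\<close> by (rule LeastI_ex)
  have N_min: "N \<le> d" if "per d" for d unfolding N_def using that by (rule Least_le)
  have mult: "c (int N * q + r) = c r" for q r
  proof (induction q rule: int_induct[of _ 0])
    case (step1 q)
    have "c (int N + (int N * q + r)) = c (0 + (int N * q + r))"
      by (rule shift) (use N per_def in auto)
    then show ?case using step1 by (simp add: algebra_simps)
  next
    case (step2 q)
    have "c (int N + (int N * (q - 1) + r)) = c (0 + (int N * (q - 1) + r))"
      by (rule shift) (use N per_def in auto)
    then show ?case using step2 by (simp add: algebra_simps)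
  qed simp
  have period: "c i = c j \<longleftrightarrow> int N dvd i - j" for i j
  proof
    assume "int N dvd i - j"
    then obtain q where "i = int N * q + j" by (metis dvdE diff_eq_eq)
    then show "c i = c j" using mult by simp
  next
    assume "c i = c j"
    then have "c (i - j) = c 0" using shift[of i j "- j"] by simp
    moreover have "i - j = int N * ((i - j) div int N) + (i - j) mod int N" by simp
    ultimately have "c ((i - j) mod int N) = c 0" using mult by metis
    moreover have "0 \<le> (i - j) mod int N" "(i - j) mod int N < int N"
      using N per_def by simp_all
    ultimately have "nat ((i - j) mod int N) = 0"
      using N_min[of "nat ((i - j) mod int N)"] by (force simp: per_def)
    then show "int N dvd i - j" using \<open>0 \<le> (i - j) mod int N\<close> by (simp add: dvd_eq_mod_eq_0)
  qed
  have "N \<noteq> 1" using N adj[of 0] by (auto simp: per_def adjacent_def)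
  moreover have "N \<noteq> 2" using N nb[of 1] by (auto simp: per_def)
  ultimately have "int N \<ge> 3" using N by (auto simp: per_def)
  then show ?thesis using that ran period nbrs by blast
qed

section \<open>Rigidity of automorphisms\<close>

text \<open>If \<open>h x\<close> differs from \<open>g x\<close>, it is \<open>g y\<close> for a
  neighbour \<open>y\<close> of \<open>x\<close>. The other neighbour \<open>z\<close> of
  \<open>x\<close> then gives a transitive triangle or an arc whose preimage under \<open>g\<close>
  does not exist.\<close>

lemma bijective_hom_isolated:
  assumes g_hom: "\<And>x y. (x, y) \<in> A \<Longrightarrow> (g x, g y) \<in> A"
    and h_hom: "\<And>x y. (x, y) \<in> A \<Longrightarrow> (h x, h y) \<in> A"
    and g_onto: "g ` V = V"
    and gh: "\<And>x y. (x, y) \<in> A \<Longrightarrow> (g x, h y) \<in> A"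
    and x: "x \<in> V"
  shows "h x = g x"
proof (rule ccontr)
  assume neq: "h x \<noteq> g x"
  have inj: "inj_on g V" using finite_V g_onto by (simp add: eq_card_imp_inj_on)
  \<comment> \<open>An injective self-map of the finite set of arcs permutes it, so \<open>g\<close>
    also reflects arcs.\<close>
  have "inj_on (map_prod g g) A"
    by (rule inj_on_subset[OF map_prod_inj_on[OF inj inj] A_sub])
  moreover have "map_prod g g ` A \<subseteq> A" using g_hom by auto
  moreover have "finite A" using finite_V A_sub by (meson finite_SigmaI finite_subset)
  ultimately have surj: "map_prod g g ` A = A" by (simp add: endo_inj_surj)
  have reflect: "(u, v) \<in> A" if "(g u, g v) \<in> A" "u \<in> V" "v \<in> V" for u v
  proof -
    have "(g u, g v) \<in> map_prod g g ` A" using surj that(1) by simp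
    then obtain u' v' where "(u', v') \<in> A" "g u' = g u" "g v' = g v" by auto
    moreover from this have "u' = u" "v' = v" using inj that A_sub by (auto dest: inj_onD)
    ultimately show ?thesis by simp
  qed
  have g_adj: "adjacent A (g u) (g v)" if "adjacent A u v" for u v
    using that adjacent_in_V[OF that] g_hom inj_onD[OF inj] unfolding adjacent_def by metis
  obtain a b where ab: "a \<noteq> b" "{w. adjacent A x w} = {a, b}" using two_neighbours x by blast
  have adj: "adjacent A x a" "adjacent A x b" using ab by blast+
  then have gab: "g a \<noteq> g b" using ab(1) adjacent_in_V inj_onD[OF inj] by metis
  have "{w. adjacent A (g x) w} = {g a, g b}"
    using neighbours_eq g_adj adj gab by blast
  moreover have gx_hx: "(g x, h x) \<in> A" using gh A_refl x by blast
  then have "adjacent A (g x) (h x)" using neq by (auto simp: adjacent_def)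
  ultimately have "h x = g a \<or> h x = g b" by blast
  then obtain y z where yz: "h x = g y" "adjacent A x y" "adjacent A x z" "g y \<noteq> g z"
    using adj gab by metis
  have "y \<in> V" "z \<in> V" using yz adjacent_in_V by blast+
  have ne: "g x \<noteq> g y" "g x \<noteq> g z"
    using g_adj[OF yz(2)] g_adj[OF yz(3)] by (auto simp: adjacent_def)
  have "(z, x) \<notin> A"
  proof
    assume zx: "(z, x) \<in> A"
    then have "(g z, g x) \<in> A" "(g z, g y) \<in> A" "(g x, g y) \<in> A"
      using g_hom gh[OF zx] gx_hx yz(1) by auto
    then show False using no_transitive_triangle[of "g z" "g x" "g y"] ne yz(4) by auto
  qed
  then have xz: "(x, z) \<in> A" using yz(3) by (auto simp: adjacent_def)
  have 1: "(g x, h z) \<in> A" using gh xz by blast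
  have 2: "(g y, h z) \<in> A" using h_hom[OF xz] yz(1) by simp
  have 3: "(g z, h z) \<in> A" using gh A_refl \<open>z \<in> V\<close> by blast
  \<comment> \<open>Two potential transitive triangles on \<open>g x\<close> and \<open>h z\<close>,
    with third vertex \<open>g y\<close> or \<open>g z\<close>, leave only \<open>h z = g x\<close>;
    reflecting the arc from \<open>g z\<close> then yields the excluded arc from \<open>z\<close> to
    \<open>x\<close>.\<close>
  have "h z = g y \<or> h z = g x"
    using no_transitive_triangle[of "g x" "g y" "h z"] 1 2 gx_hx yz(1) ne by auto
  moreover have "h z = g z \<or> h z = g x"
    using no_transitive_triangle[of "g x" "g z" "h z"] 1 3 g_hom[OF xz] ne by auto
  ultimately have "h z = g x" using yz(4) by auto
  then show False using reflect[of z x] 3 \<open>z \<in> V\<close> x \<open>(z, x) \<notin> A\<close> by simp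
qed

end

section \<open>Polymorphisms of oriented cycles\<close>

text \<open>Here \<open>f\<close> takes arbitrary functions, and \<open>f_cong\<close> makes it
  ignore arguments from \<open>k\<close> on, so that updates need no care about
  extensionality.\<close>

locale circle_polymorphism = circle_digraph +
  fixes k :: nat and f :: "(nat \<Rightarrow> 'a) \<Rightarrow> 'a"
  assumes f_hom: "(\<And>i. i < k \<Longrightarrow> (x i, y i) \<in> A) \<Longrightarrow> (f x, f y) \<in> A"
    and f_cong: "(\<And>i. i < k \<Longrightarrow> x i = y i) \<Longrightarrow> f x = f y"
begin

lemma f_in_V: "(\<And>i. i < k \<Longrightarrow> x i \<in> V) \<Longrightarrow> f x \<in> V"
  using f_hom[of x x] A_refl A_sub by blast

lemma converse_polymorphism: "circle_polymorphism V (A\<inverse>) k f"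
proof -
  interpret conv: circle_digraph V "A\<inverse>" by (rule converse)
  show ?thesis
  proof
    show "(f x, f y) \<in> A\<inverse>" if "\<And>i. i < k \<Longrightarrow> (x i, y i) \<in> A\<inverse>" for x y
      using f_hom[of y x] that by simp
  qed (rule f_cong)
qed

text \<open>When the parameters are joined by arcs, the two sections are related as \<open>g\<close>
  and \<open>h\<close> are in \<open>bijective_hom_isolated\<close>.\<close>

lemma section_constant:
  assumes onto: "(\<lambda>t. f (z(i := t))) ` V = V"
    and zz': "\<And>l. l < k \<Longrightarrow> (z l, z' l) \<in> A"
    and t: "t \<in> V"
  shows "f (z'(i := t)) = f (z(i := t))"
proof (rule bijective_hom_isolated[where g = "\<lambda>t. f (z(i := t))" and h = "\<lambda>t. f (z'(i := t))"])
  have V: "z l \<in> V" "z' l \<in> V" if "l < k" for l using zz'[OF that] A_sub by auto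
  show "(f (z(i := x)), f (z(i := y))) \<in> A" "(f (z'(i := x)), f (z'(i := y))) \<in> A"
    "(f (z(i := x)), f (z'(i := y))) \<in> A" if "(x, y) \<in> A" for x y
    using that V A_refl zz' by (auto intro!: f_hom)
qed (use onto t in auto)

lemma section_constant_adjacent:
  assumes onto: "(\<lambda>t. f (z(i := t))) ` V = V"
    and z: "\<And>l. l < k \<Longrightarrow> z l \<in> V"
    and adj: "adjacent A (z j) b"
    and t: "t \<in> V"
  shows "f (z(j := b, i := t)) = f (z(i := t))"
proof -
  interpret conv: circle_polymorphism V "A\<inverse>" k f by (rule converse_polymorphism)
  from adj consider "(z j, b) \<in> A" | "(b, z j) \<in> A" by (auto simp: adjacent_def)
  then show ?thesis
  proof cases
    case 1
    then show ?thesis using z A_refl t by (intro section_constant[OF onto]) auto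
  next
    case 2
    then show ?thesis using z A_refl t by (intro conv.section_constant[OF onto]) auto
  qed
qed

text \<open>The parameters are changed one coordinate at a time, each along a path in the graph.
  Every step preserves the section, which therefore stays onto and permits the next step.\<close>

lemma onto_section_unary:
  assumes onto: "(\<lambda>t. f (z(i := t))) ` V = V"
    and z: "\<And>l. l < k \<Longrightarrow> z l \<in> V" and i: "i < k"
    and x: "\<And>l. l < k \<Longrightarrow> x l \<in> V"
  shows "f x = f (z(i := x i))"
proof -
  have "\<forall>t\<in>V. f (x(i := t)) = f (z(i := t))"
    if "\<And>l. l < k \<Longrightarrow> x l \<in> V" "\<And>l. m \<le> l \<Longrightarrow> l < k \<Longrightarrow> x l = z l" for m x
    using that
  proof (induction m arbitrary: x)
    case 0
    then show ?case by (auto intro!: f_cong)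
  next
    case (Suc m)
    show ?case
    proof (cases "m < k")
      case False
      then show ?thesis using Suc.IH[of x] Suc.prems by auto
    next
      case True
      let ?y = "x(m := z m)"
      have y: "?y l \<in> V" if "l < k" for l using that Suc.prems(1) z by simp
      have "\<forall>t\<in>V. f (x(m := b, i := t)) = f (z(i := t))" if "b \<in> V" for b
      proof (rule connected_induct[of "z m" b])
        show "\<forall>t\<in>V. f (x(m := z m, i := t)) = f (z(i := t))"
        proof (rule Suc.IH)
          show "?y l = z l" if "m \<le> l" "l < k" for l
            using that Suc.prems(2)[of l] by (cases "l = m") auto
        qed (rule y)
      next
        fix b b' assume b: "\<forall>t\<in>V. f (x(m := b, i := t)) = f (z(i := t))" and adj: "adjacent A b b'"
        have "(\<lambda>t. f (x(m := b, i := t))) ` V = V"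
          using onto b by (auto simp: image_def)
        from section_constant_adjacent[OF this, of m b']
        show "\<forall>t\<in>V. f (x(m := b', i := t)) = f (z(i := t))"
          using b adj adjacent_in_V[OF adj] Suc.prems(1) by simp
      qed (use z True that in auto)
      from this[of "x m"] show ?thesis using Suc.prems(1) True by (simp del: fun_upd_apply)
    qed
  qed
  from this[of x k] show ?thesis using x i by force
qed

end

text \<open>The case in which every one-variable section misses a vertex and so does not wind around
  the cycle; \<open>c\<close> is the covering of the cycle by the integers.\<close>

locale null_polymorphism = circle_polymorphism +
  fixes c :: "int \<Rightarrow> 'a" and n :: int
  assumes n3: "n \<ge> 3"
    and c_range: "range c = V"
    and c_eq: "c i = c j \<longleftrightarrow> n dvd i - j"
    and c_nbrs: "{w. adjacent A (c i) w} = {c (i - 1), c (i + 1)}"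
    and no_onto_section: "m < k \<Longrightarrow> (\<And>l. l < k \<Longrightarrow> z l \<in> V) \<Longrightarrow> (\<lambda>t. f (z(m := t))) ` V \<noteq> V"
begin

section \<open>Lifting a polymorphism to the universal cover\<close>

lemma c_in_V: "c i \<in> V"
  using c_range by blast

lemma arc_lift:
  assumes "(c i, c j) \<in> A \<or> (c j, c i) \<in> A"
  obtains d where "\<bar>d\<bar> \<le> 1" "n dvd j - (i + d)"
proof (cases "c i = c j")
  case True
  then have "n dvd i - j" using c_eq by blast
  then have "n dvd j - (i + 0)" by (metis add.right_neutral dvd_minus_iff minus_diff_eq)
  then show ?thesis using that[of 0] by simp
next
  case False
  then have "c j \<in> {w. adjacent A (c i) w}" using assms by (auto simp: adjacent_def)
  then have "c j = c (i + -1) \<or> c j = c (i + 1)" unfolding c_nbrs by auto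
  then show ?thesis using that[of "-1"] that[of 1] c_eq by auto
qed

lemma close_neq: "0 < \<bar>i - j\<bar> \<Longrightarrow> \<bar>i - j\<bar> < n \<Longrightarrow> c i \<noteq> c j"
  using c_eq zdvd_not_zless[of "\<bar>i - j\<bar>" n] by simp

text \<open>Two distances of at most one bound the third by two, which is less than
  \<open>n\<close>. As the images form a transitive triple, two of them coincide, hence so do two of
  the integers.\<close>

lemma transitive_triangle_close:
  assumes "(c u, c v) \<in> A" "(c v, c w) \<in> A" "(c u, c w) \<in> A"
  shows "\<bar>u - v\<bar> \<le> 1 \<Longrightarrow> \<bar>v - w\<bar> \<le> 1 \<Longrightarrow> \<bar>u - w\<bar> \<le> 1"
    and "\<bar>u - v\<bar> \<le> 1 \<Longrightarrow> \<bar>u - w\<bar> \<le> 1 \<Longrightarrow> \<bar>v - w\<bar> \<le> 1"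
    and "\<bar>u - w\<bar> \<le> 1 \<Longrightarrow> \<bar>v - w\<bar> \<le> 1 \<Longrightarrow> \<bar>u - v\<bar> \<le> 1"
proof -
  have *: "u = v \<or> v = w \<or> u = w" if "\<bar>u - v\<bar> < n" "\<bar>v - w\<bar> < n" "\<bar>u - w\<bar> < n"
    using no_transitive_triangle[OF assms] close_neq[of u v] close_neq[of v w] close_neq[of u w] that
    by auto
  show "\<bar>u - v\<bar> \<le> 1 \<Longrightarrow> \<bar>v - w\<bar> \<le> 1 \<Longrightarrow> \<bar>u - w\<bar> \<le> 1"
    "\<bar>u - v\<bar> \<le> 1 \<Longrightarrow> \<bar>u - w\<bar> \<le> 1 \<Longrightarrow> \<bar>v - w\<bar> \<le> 1"
    "\<bar>u - w\<bar> \<le> 1 \<Longrightarrow> \<bar>v - w\<bar> \<le> 1 \<Longrightarrow> \<bar>u - v\<bar> \<le> 1"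
    using * n3 by linarith+
qed

text \<open>A map of the cycle that misses a vertex lifts to the interval between two consecutive
  preimages of that vertex.\<close>

lemma unary_lift:
  assumes g: "\<And>x y. (x, y) \<in> A \<Longrightarrow> (g x, g y) \<in> A"
    and not_onto: "g ` V \<noteq> V"
    and base: "b \<in> V" "c h = g b"
  obtains H where "\<And>t. t \<in> V \<Longrightarrow> c (H t) = g t" "H b = h"
    "\<And>s t. (s, t) \<in> A \<Longrightarrow> \<bar>H s - H t\<bar> \<le> 1"
proof -
  have gV: "g t \<in> V" if "t \<in> V" for t using g[of t t] A_refl A_sub that by blast
  then obtain m where m: "c m \<notin> g ` V" using not_onto c_range
    by (metis image_subset_iff rangeE subsetI subset_antisym)
  have "\<exists>j. c j = g t \<and> m < j \<and> j < m + n" if t: "t \<in> V" for t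
  proof -
    obtain i where i: "c i = g t" using gV[OF t] c_range by (metis rangeE)
    define j where "j = m + (i - m) mod n"
    have "j - i = - (n * ((i - m) div n))"
      using mult_div_mod_eq[of n "i - m"] unfolding j_def by linarith
    then have "c j = g t" using i c_eq by (metis dvd_minus_iff dvd_triv_left)
    moreover have "m \<le> j" "j < m + n" using n3 by (simp_all add: j_def)
    moreover have "m \<noteq> j" using m t calculation(1) by auto
    ultimately show ?thesis by force
  qed
  then obtain H0 where H0: "\<And>t. t \<in> V \<Longrightarrow> c (H0 t) = g t \<and> m < H0 t \<and> H0 t < m + n" by metis
  define H where "H = (\<lambda>t. H0 t + (h - H0 b))"
  have dvd: "n dvd h - H0 b" using base H0 c_eq by metis
  show ?thesis
  proof
    show "c (H t) = g t" if "t \<in> V" for t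
    proof -
      have "c (H t) = c (H0 t)" unfolding c_eq H_def using dvd by simp
      then show ?thesis using H0 that by simp
    qed
    show "H b = h" by (simp add: H_def)
    fix s t assume st: "(s, t) \<in> A"
    then have "s \<in> V" "t \<in> V" using A_sub by auto
    have "(c (H0 s), c (H0 t)) \<in> A" using g[OF st] H0 \<open>s \<in> V\<close> \<open>t \<in> V\<close> by simp
    then obtain d where d: "\<bar>d\<bar> \<le> 1" "n dvd H0 t - (H0 s + d)" by (meson arc_lift)
    \<comment> \<open>Both values lie strictly between \<open>m\<close> and \<open>m + n\<close>, so
      they differ by at most \<open>n - 2\<close>, which leaves room for \<open>d\<close>.\<close>
    have "\<bar>H0 t - (H0 s + d)\<bar> < n"
      using H0[OF \<open>s \<in> V\<close>] H0[OF \<open>t \<in> V\<close>] d(1) by linarith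
    then have "H0 t - (H0 s + d) = 0" using d(2)
      by (metis dvd_imp_le_int linorder_not_less abs_of_nonneg n3 order_trans zero_le_numeral)
    then show "\<bar>H s - H t\<bar> \<le> 1" using d(1) by (simp add: H_def)
  qed
qed

text \<open>Induction on the number of coordinates that may differ from a base vertex
  \<open>b\<close>. The next coordinate is released by lifting each section in its direction,
  starting from the value already chosen at \<open>b\<close>.\<close>

lemma lift:
  obtains F :: "(nat \<Rightarrow> 'a) \<Rightarrow> int" where
    "\<And>x. (\<And>i. i < k \<Longrightarrow> x i \<in> V) \<Longrightarrow> c (F x) = f x"
    "\<And>x y. (\<And>i. i < k \<Longrightarrow> (x i, y i) \<in> A) \<Longrightarrow> \<bar>F x - F y\<bar> \<le> 1"
proof -
  obtain b where b: "b \<in> V" using V_nonempty by blast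
  define D where "D = (\<lambda>m. {x. (\<forall>i<k. x i \<in> V) \<and> (\<forall>i<k. m \<le> i \<longrightarrow> x i = b)})"
  have "\<exists>F. (\<forall>x\<in>D m. c (F x) = f x)
      \<and> (\<forall>x\<in>D m. \<forall>y\<in>D m. (\<forall>i<k. (x i, y i) \<in> A) \<longrightarrow> \<bar>F x - F y\<bar> \<le> 1)" for m
  proof (induction m)
    case 0
    have "f (\<lambda>_. b) \<in> V" using b f_in_V by simp
    then obtain h where h: "c h = f (\<lambda>_. b)" using c_range by (metis rangeE)
    have "f x = f (\<lambda>_. b)" if "x \<in> D 0" for x
      by (rule f_cong) (use that in \<open>simp add: D_def\<close>)
    then show ?case using h by (intro exI[of _ "\<lambda>_. h"]) auto
  next
    case (Suc m)
    then obtain F where F: "\<And>x. x \<in> D m \<Longrightarrow> c (F x) = f x"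
      "\<And>x y. x \<in> D m \<Longrightarrow> y \<in> D m \<Longrightarrow> (\<forall>i<k. (x i, y i) \<in> A) \<Longrightarrow> \<bar>F x - F y\<bar> \<le> 1" by blast
    show ?case
    proof (cases "m < k")
      case False
      then have "D (Suc m) = D m" by (auto simp: D_def)
      then show ?thesis using F by (intro exI[of _ F]) auto
    next
      case True
      have "\<exists>H. (\<forall>t\<in>V. c (H t) = f (z(m := t))) \<and> H b = F z
          \<and> (\<forall>s t. (s, t) \<in> A \<longrightarrow> \<bar>H s - H t\<bar> \<le> 1)" if z: "z \<in> D m" for z
      proof -
        have zb: "z(m := b) = z" using z True by (auto simp: D_def fun_eq_iff)
        have zV: "z l \<in> V" if "l < k" for l using z that by (simp add: D_def)
        obtain H where "\<And>t. t \<in> V \<Longrightarrow> c (H t) = f (z(m := t))" "H b = F z"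
          "\<And>s t. (s, t) \<in> A \<Longrightarrow> \<bar>H s - H t\<bar> \<le> 1"
        proof (rule unary_lift[of "\<lambda>t. f (z(m := t))" b "F z"])
          show "(f (z(m := x)), f (z(m := y))) \<in> A" if "(x, y) \<in> A" for x y
            using that zV A_refl by (intro f_hom) simp
          show "(\<lambda>t. f (z(m := t))) ` V \<noteq> V" using no_onto_section True zV by blast
          show "c (F z) = f (z(m := b))" using F(1)[OF z] zb by simp
        qed (use b in auto)
        then show ?thesis by blast
      qed
      then obtain H where H: "\<And>z t. z \<in> D m \<Longrightarrow> t \<in> V \<Longrightarrow> c (H z t) = f (z(m := t))"
        "\<And>z. z \<in> D m \<Longrightarrow> H z b = F z"
        "\<And>z s t. z \<in> D m \<Longrightarrow> (s, t) \<in> A \<Longrightarrow> \<bar>H z s - H z t\<bar> \<le> 1" by metis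
      have arc: "(c (H z s), c (H w t)) \<in> A"
        if "z \<in> D m" "w \<in> D m" "\<forall>i<k. (z i, w i) \<in> A" "(s, t) \<in> A" for z w s t
      proof -
        have "s \<in> V" "t \<in> V" using that(4) A_sub by auto
        moreover have "(f (z(m := s)), f (w(m := t))) \<in> A" using that by (intro f_hom) simp
        ultimately show ?thesis using H(1) that by simp
      qed
      have refl: "\<forall>i<k. (z i, z i) \<in> A" if "z \<in> D m" for z
        using that A_refl by (simp add: D_def)
      \<comment> \<open>The lifts over \<open>z\<close> and \<open>w\<close> are close at
        \<open>b\<close>. Along an edge from \<open>s\<close> to \<open>t\<close> closeness is
        passed on, as the square over \<open>z\<close>, \<open>w\<close>, \<open>s\<close>,
        \<open>t\<close> is cut by a diagonal into two transitive triangles.\<close>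
      have near: "\<bar>H z t - H w t\<bar> \<le> 1"
        if z: "z \<in> D m" and w: "w \<in> D m" and zw: "\<forall>i<k. (z i, w i) \<in> A" and "t \<in> V" for z w t
        using b \<open>t \<in> V\<close>
      proof (induction rule: connected_induct)
        case base
        then show ?case using H(2) F(2) z w zw by simp
      next
        case (step s t)
        have s: "(s, s) \<in> A" "(t, t) \<in> A" using adjacent_in_V[OF step(2)] A_refl by auto
        from step(2) consider "(s, t) \<in> A" | "(t, s) \<in> A" by (auto simp: adjacent_def)
        then show ?case
        proof cases
          case 1
          have "\<bar>H z s - H w t\<bar> \<le> 1"
            using transitive_triangle_close(1)[of "H z s" "H w s" "H w t"] arc z w zw refl s 1
              step(1) H(3)[OF w 1] by blast
          then show ?thesis
            using transitive_triangle_close(2)[of "H z s" "H z t" "H w t"] arc z w zw refl s 1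
              H(3)[OF z 1] by blast
        next
          case 2
          have "\<bar>H z t - H w s\<bar> \<le> 1"
            using transitive_triangle_close(1)[of "H z t" "H z s" "H w s"] arc z w zw refl s 2
              step(1) H(3)[OF z 2] by blast
          then show ?thesis
            using transitive_triangle_close(3)[of "H z t" "H w t" "H w s"] arc z w zw refl s 2
              H(3)[OF w 2] by blast
        qed
      qed
      define F' where "F' = (\<lambda>x. H (x(m := b)) (x m))"
      have D: "x(m := b) \<in> D m" if "x \<in> D (Suc m)" for x
        using that b by (auto simp: D_def)
      have V: "x m \<in> V" if "x \<in> D (Suc m)" for x using that True by (simp add: D_def)
      have "c (F' x) = f x" if "x \<in> D (Suc m)" for x
        using H(1)[OF D[OF that] V[OF that]] by (simp add: F'_def)
      moreover have "\<bar>F' x - F' y\<bar> \<le> 1"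
        if x: "x \<in> D (Suc m)" and y: "y \<in> D (Suc m)" and xy: "\<forall>i<k. (x i, y i) \<in> A" for x y
      proof -
        let ?z = "x(m := b)" and ?w = "y(m := b)"
        have zw: "\<forall>i<k. (?z i, ?w i) \<in> A" using xy A_refl b by simp
        have xm: "(x m, y m) \<in> A" "(x m, x m) \<in> A" using xy True V[OF x] A_refl by auto
        show ?thesis unfolding F'_def
          using transitive_triangle_close(1)[of "H ?z (x m)" "H ?w (x m)" "H ?w (y m)"]
            arc[OF D[OF x] D[OF y] zw] arc[OF D[OF y] D[OF y] refl[OF D[OF y]]] xm
            near[OF D[OF x] D[OF y] zw V[OF x]] H(3)[OF D[OF y] xm(1)] by blast
      qed
      ultimately show ?thesis by (intro exI[of _ F']) blast
    qed
  qed
  from this[of k] obtain F where "\<And>x. x \<in> D k \<Longrightarrow> c (F x) = f x"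
    "\<And>x y. x \<in> D k \<Longrightarrow> y \<in> D k \<Longrightarrow> (\<forall>i<k. (x i, y i) \<in> A) \<Longrightarrow> \<bar>F x - F y\<bar> \<le> 1" by blast
  moreover have "x \<in> D k \<longleftrightarrow> (\<forall>i<k. x i \<in> V)" for x by (auto simp: D_def)
  moreover have "(\<forall>i<k. x i \<in> V) \<and> (\<forall>i<k. y i \<in> V)" if "\<And>i. i < k \<Longrightarrow> (x i, y i) \<in> A" for x y
    using that A_sub by blast
  ultimately show ?thesis using that by metis
qed

text \<open>If \<open>F x\<close> is the least value of the lift, all values lie between
  \<open>F x\<close> and \<open>F x + n - 2\<close>, so the vertex \<open>c (F x + n - 1)\<close> is
  missed.\<close>

lemma not_onto: "\<exists>v\<in>V. \<forall>x. (\<forall>i<k. x i \<in> V) \<longrightarrow> f x \<noteq> v"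
proof (rule ccontr)
  assume "\<not> ?thesis"
  then have onto: "\<exists>x. (\<forall>i<k. x i \<in> V) \<and> f x = v" if "v \<in> V" for v using that by blast
  obtain F0 where F0: "\<And>x. (\<And>i. i < k \<Longrightarrow> x i \<in> V) \<Longrightarrow> c (F0 x) = f x"
    "\<And>x y. (\<And>i. i < k \<Longrightarrow> (x i, y i) \<in> A) \<Longrightarrow> \<bar>F0 x - F0 y\<bar> \<le> 1"
    by (rule lift) blast
  define E where "E = (\<lambda>a b. \<bar>a - b\<bar> \<le> 1 \<and> (c a, c b) \<in> A)"
  \<comment> \<open>Arguments from \<open>k\<close> on are set to a fixed value because
    \<open>F0\<close> might depend on them, while \<open>F\<close> has to be periodic.\<close>
  define F where "F = (\<lambda>x. F0 (\<lambda>i. if i < k then c (x i) else undefined))"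
  have cF: "c (F x) = f (\<lambda>i. c (x i))" for x
  proof -
    have "c (F x) = f (\<lambda>i. if i < k then c (x i) else undefined)"
      unfolding F_def by (rule F0(1)) (simp add: c_in_V)
    also have "\<dots> = f (\<lambda>i. c (x i))" by (rule f_cong) simp
    finally show ?thesis .
  qed
  interpret periodic_hom E n k F
  proof
    fix a
    have "adjacent A (c a) (c (a + 1))" using c_nbrs[of a] by blast
    then show "E a (a + 1) \<or> E (a + 1) a" by (auto simp: E_def adjacent_def)
  next
    fix x y assume *: "\<And>i. i < k \<Longrightarrow> E (x i) (y i)"
    then have "(f (\<lambda>i. c (x i)), f (\<lambda>i. c (y i))) \<in> A" by (intro f_hom) (simp add: E_def)
    moreover have "\<bar>F x - F y\<bar> \<le> 1" unfolding F_def
      by (rule F0(2)) (use * in \<open>simp add: E_def\<close>)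
    ultimately show "E (F x) (F y)" by (simp add: E_def cF)
  next
    fix x y assume *: "\<And>i. i < k \<Longrightarrow> n dvd x i - y i"
    then have "(\<lambda>i. if i < k then c (x i) else undefined) = (\<lambda>i. if i < k then c (y i) else undefined)"
      using c_eq by (auto simp: fun_eq_iff)
    then show "F x = F y" by (simp add: F_def)
  qed (use n3 A_refl c_in_V in \<open>auto simp: E_def\<close>)
  have bound: "F y \<le> F x + n - 2" for x y
  proof (rule oscillation_bound)
    fix a assume n: "n = 3"
    \<comment> \<open>On three vertices, two two-way edges together with the third edge, in either
      direction, form a transitive triangle.\<close>
    show "strict a \<or> strict (a + 1)"
    proof (rule ccontr)
      assume "\<not> ?thesis"
      then have "(c a, c (a + 1)) \<in> A" "(c (a + 1), c a) \<in> A"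
        "(c (a + 1), c (a + 2)) \<in> A" "(c (a + 2), c (a + 1)) \<in> A"
        using not_strictD[of a] not_strictD[of "a + 1"] by (auto simp: E_def add.assoc)
      moreover have "c (a - 1) = c (a + 2)" using n by (simp add: c_eq)
      then have "adjacent A (c a) (c (a + 2))" using c_nbrs[of a] by auto
      then have "(c a, c (a + 2)) \<in> A \<or> (c (a + 2), c a) \<in> A" by (auto simp: adjacent_def)
      ultimately show False
        using no_transitive_triangle[of "c a" "c (a + 1)" "c (a + 2)"]
          no_transitive_triangle[of "c (a + 2)" "c (a + 1)" "c a"]
          close_neq[of a "a + 1"] close_neq[of "a + 1" "a + 2"] close_neq[of a "a + 2"] n by auto
    qed
  qed
  have lifts: "\<exists>x. c (F x) = v" if v: "v \<in> V" for v
  proof -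
    obtain x where x: "\<forall>i<k. x i \<in> V" "f x = v" using onto v by blast
    then have "\<forall>i. \<exists>a. i < k \<longrightarrow> c a = x i" using c_range by (metis rangeE)
    then obtain y where y: "\<And>i. i < k \<Longrightarrow> c (y i) = x i" by metis
    have "c (F y) = f x" unfolding cF by (rule f_cong) (simp add: y)
    then show ?thesis using x by blast
  qed
  have "\<exists>x. \<forall>y. F x \<le> F y"
  proof -
    \<comment> \<open>Subtracting a lower bound of \<open>F\<close> makes \<open>nat\<close>
      faithful on its values, so a least one exists.\<close>
    define m where "m = (LEAST m. \<exists>x. m = nat (F x - (F (\<lambda>_. 0) - n)))"
    have "\<exists>x. m = nat (F x - (F (\<lambda>_. 0) - n))" unfolding m_def by (rule LeastI) auto
    then obtain x where x: "m = nat (F x - (F (\<lambda>_. 0) - n))" by blast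
    have "m \<le> nat (F y - (F (\<lambda>_. 0) - n))" for y unfolding m_def by (rule Least_le) auto
    moreover have "F y \<ge> F (\<lambda>_. 0) - n + 2" for y using bound[of "\<lambda>_. 0" y] by linarith
    ultimately have "F x \<le> F y" for y using x by (smt (verit) nat_le_eq_zle)
    then show ?thesis by blast
  qed
  then obtain x where x: "\<And>y. F x \<le> F y" by blast
  obtain y where "c (F y) = c (F x + n - 1)" using lifts c_in_V by metis
  moreover have "c (F y) \<noteq> c (F x + n - 1)"
    by (rule close_neq) (use x[of y] bound[of y x] n3 in linarith)+
  ultimately show False by blast
qed

end

context circle_polymorphism
begin

theorem onto_imp_unary:
  assumes onto: "\<And>v. v \<in> V \<Longrightarrow> \<exists>x. (\<forall>i<k. x i \<in> V) \<and> f x = v"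
  obtains i g where "i < k" "\<And>x. (\<And>l. l < k \<Longrightarrow> x l \<in> V) \<Longrightarrow> f x = g (x i)"
    "\<And>x y. (x, y) \<in> A \<Longrightarrow> (g x, g y) \<in> A"
proof (cases "\<exists>i<k. \<exists>z. (\<forall>l<k. z l \<in> V) \<and> (\<lambda>t. f (z(i := t))) ` V = V")
  case True
  then obtain i z where i: "i < k" and z: "\<forall>l<k. z l \<in> V" "(\<lambda>t. f (z(i := t))) ` V = V" by blast
  show ?thesis
  proof (rule that[of i "\<lambda>t. f (z(i := t))"])
    show "f x = f (z(i := x i))" if "\<And>l. l < k \<Longrightarrow> x l \<in> V" for x
      using onto_section_unary z i that by blast
    show "(f (z(i := x)), f (z(i := y))) \<in> A" if "(x, y) \<in> A" for x y
      using that z A_refl by (intro f_hom) simp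
  qed (rule i)
next
  case False
  obtain c n where c: "(n::int) \<ge> 3" "range c = V" "\<And>i j. c i = c j \<longleftrightarrow> n dvd i - j"
    "\<And>i. {w. adjacent A (c i) w} = {c (i - 1), c (i + 1)}"
    by (rule universal_cover) blast
  interpret null_polymorphism V A k f c n
  proof
    show "(\<lambda>t. f (z(m := t))) ` V \<noteq> V" if "m < k" "\<And>l. l < k \<Longrightarrow> z l \<in> V" for m z
      using False that by blast
  qed (fact c)+
  show ?thesis using not_onto onto by blast
qed

end

section \<open>Triangulations of the circle\<close>

lemma realisation_topology: "subtopology (powertop_real UNIV) S = top_of_set S"
  by (simp add: euclidean_product_topology)

text \<open>\<open>C\<close> is the carrier of \<open>nsphere 1\<close>. Removing a point leaves the
  image of an open interval under \<open>\<gamma>\<close>; removing two leaves points strictly on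
  both sides of the line through them.\<close>

lemma circle_facts:
  defines "C \<equiv> {x :: nat \<Rightarrow> real. (\<Sum>i\<le>1. (x i)\<^sup>2) = 1 \<and> (\<forall>i>1. x i = 0)}"
  shows "connected C" "p \<in> C \<Longrightarrow> connected (C - {p})"
    "p \<in> C \<Longrightarrow> q \<in> C \<Longrightarrow> p \<noteq> q \<Longrightarrow> \<not> connected (C - {p, q})"
    "\<exists>p\<in>C. \<exists>q\<in>C. p \<noteq> q"
proof -
  define \<gamma> :: "real \<Rightarrow> nat \<Rightarrow> real" where
    "\<gamma> = (\<lambda>\<theta> i. if i = 0 then cos \<theta> else if i = 1 then sin \<theta> else 0)"
  have C_iff: "x \<in> C \<longleftrightarrow> (x 0)\<^sup>2 + (x 1)\<^sup>2 = 1 \<and> (\<forall>i>1. x i = 0)" for x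
    by (simp add: C_def)
  have ext: "x = y" if "x \<in> C" "y \<in> C" "x 0 = y 0" "x 1 = y 1" for x y
  proof
    fix i :: nat
    consider "i = 0" | "i = 1" | "i > 1" by linarith
    then show "x i = y i" using that by cases (auto simp: C_iff)
  qed
  have \<gamma>C: "\<gamma> \<theta> \<in> C" for \<theta> by (simp add: C_iff \<gamma>_def)
  have cont: "continuous_on S \<gamma>" for S
    unfolding \<gamma>_def
  proof (rule continuous_on_coordinatewise_then_product)
    show "continuous_on S (\<lambda>\<theta>. if i = 0 then cos \<theta> else if i = 1 then sin \<theta> else 0)" for i :: nat
      by (cases "i = 0"; cases "i = 1") (auto intro!: continuous_intros)
  qed
  have \<gamma>_onto: "\<exists>\<theta>\<in>{\<alpha>..<\<alpha> + 2 * pi}. x = \<gamma> \<theta>" if x: "x \<in> C" for x \<alpha>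
  proof -
    obtain t where t: "x 0 = cos t" "x 1 = sin t"
      using sincos_total_2pi_le[of "x 0" "x 1"] x by (auto simp: C_iff)
    define m where "m = \<lfloor>(t - \<alpha>) / (2 * pi)\<rfloor>"
    define \<theta> where "\<theta> = t - of_int m * (2 * pi)"
    have "of_int m \<le> (t - \<alpha>) / (2 * pi)" "(t - \<alpha>) / (2 * pi) < of_int m + 1"
      unfolding m_def by linarith+
    then have "\<theta> \<in> {\<alpha>..<\<alpha> + 2 * pi}"
      unfolding \<theta>_def by (simp add: field_simps)
    moreover have "cos \<theta> = cos t" "sin \<theta> = sin t"
      using sin_int_2pin[of m] cos_int_2pin[of m]
      unfolding \<theta>_def by (simp_all add: cos_diff sin_diff mult.commute)
    then have "x = \<gamma> \<theta>" using t by (intro ext[OF x \<gamma>C]) (simp_all add: \<gamma>_def)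
    ultimately show ?thesis by blast
  qed
  have "C = range \<gamma>" using \<gamma>C \<gamma>_onto by blast
  then show "connected C" using connected_continuous_image[OF cont[of UNIV]] by simp
  show "connected (C - {p})" if p: "p \<in> C"
  proof -
    obtain \<alpha> where \<alpha>: "p = \<gamma> \<alpha>" using \<gamma>_onto[OF p, of 0] by blast
    have "C - {p} = \<gamma> ` {\<alpha><..<\<alpha> + 2 * pi}"
    proof (intro equalityI subsetI)
      fix x assume x: "x \<in> C - {p}"
      then obtain \<theta> where \<theta>: "\<theta> \<in> {\<alpha>..<\<alpha> + 2 * pi}" "x = \<gamma> \<theta>" using \<gamma>_onto by blast
      moreover have "\<theta> \<noteq> \<alpha>" using x \<theta>(2) \<alpha> by auto
      ultimately show "x \<in> \<gamma> ` {\<alpha><..<\<alpha> + 2 * pi}" by auto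
    next
      fix x assume "x \<in> \<gamma> ` {\<alpha><..<\<alpha> + 2 * pi}"
      then obtain \<theta> where \<theta>: "\<alpha> < \<theta>" "\<theta> < \<alpha> + 2 * pi" "x = \<gamma> \<theta>" by auto
      have "\<gamma> \<theta> \<noteq> \<gamma> \<alpha>"
      proof
        assume eq: "\<gamma> \<theta> = \<gamma> \<alpha>"
        have "cos \<theta> = cos \<alpha>" "sin \<theta> = sin \<alpha>"
          using fun_cong[OF eq, of 0] fun_cong[OF eq, of 1] by (simp_all add: \<gamma>_def)
        then have "cos (\<theta> - \<alpha>) = 1"
          by (simp add: cos_diff flip: power2_eq_square)
        then obtain m :: int where m: "\<theta> - \<alpha> = of_int m * 2 * pi"
          using cos_one_2pi_int by auto
        then have "of_int m * (2 * pi) = \<theta> - \<alpha>" by simp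
        then have "0 < of_int m * (2 * pi)" "of_int m * (2 * pi) < 1 * (2 * pi)"
          using \<theta>(1,2) by simp_all
        then have "(0::real) < of_int m" "of_int m < (1::real)"
          by (simp_all add: zero_less_mult_iff mult_less_cancel_right)
        then show False by simp
      qed
      then show "x \<in> C - {p}" using \<gamma>C \<alpha> \<theta>(3) by auto
    qed
    then show ?thesis using connected_continuous_image[OF cont] by simp
  qed
  show "\<not> connected (C - {p, q})" if p: "p \<in> C" and q: "q \<in> C" and "p \<noteq> q"
  proof
    assume con: "connected (C - {p, q})"
    text \<open>The line through \<open>p\<close> and \<open>q\<close> separates.\<close>
    define L where "L = (\<lambda>x :: nat \<Rightarrow> real. (p 1 - q 1) * (x 0 - p 0) - (p 0 - q 0) * (x 1 - p 1))"
    have Lcont: "continuous_on UNIV L"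
      unfolding L_def by (intro continuous_intros continuous_on_product_coordinates)
    have pq: "p 0 \<noteq> q 0 \<or> p 1 \<noteq> q 1" using ext[OF p q] \<open>p \<noteq> q\<close> by blast
    define D where "D = sqrt ((p 0 - q 0)\<^sup>2 + (p 1 - q 1)\<^sup>2)"
    have D2: "D\<^sup>2 = (p 0 - q 0)\<^sup>2 + (p 1 - q 1)\<^sup>2" by (simp add: D_def)
    have D0: "D > 0" using pq by (auto simp: D_def sum_power2_gt_zero_iff)
    \<comment> \<open>\<open>\<nu>\<close> is a unit normal of the chord and \<open>D\<close> the
      length of the chord; the points \<open>\<nu>\<close> and \<open>- \<nu>\<close> of the circle
      turn out to lie on opposite sides.\<close>
    define \<nu> :: "nat \<Rightarrow> real" where
      "\<nu> = (\<lambda>i. if i = 0 then (p 1 - q 1) / D else if i = 1 then - (p 0 - q 0) / D else 0)"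
    have "(- (p 0 - q 0) / D)\<^sup>2 + ((p 1 - q 1) / D)\<^sup>2 = D\<^sup>2 / D\<^sup>2"
      by (simp only: power_divide power2_minus add_divide_distrib[symmetric] D2)
    then have "(\<nu> 0)\<^sup>2 + (\<nu> 1)\<^sup>2 = 1" using D0 by (simp add: \<nu>_def)
    then have \<nu>C: "\<nu> \<in> C" "(\<lambda>i. - \<nu> i) \<in> C"
      by (auto simp: C_iff) (auto simp: \<nu>_def)
    define e where "e = (p 1 - q 1) * p 0 - (p 0 - q 0) * p 1"
    have p1: "(p 0)\<^sup>2 + (p 1)\<^sup>2 = 1" and q1: "(q 0)\<^sup>2 + (q 1)\<^sup>2 = 1" using p q C_iff by blast+
    \<comment> \<open>The line is at distance \<open>\<bar>e\<bar> / D\<close> from the centre. The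
      gap \<open>D\<^sup>2 - e\<^sup>2\<close> is the square of the inner product of
      \<open>p - q\<close> with \<open>p\<close>, which equals half of
      \<open>D\<^sup>2\<close>.\<close>
    have "e\<^sup>2 < D\<^sup>2"
    proof -
      have e: "D\<^sup>2 - e\<^sup>2 = ((p 0 - q 0) * p 0 + (p 1 - q 1) * p 1)\<^sup>2"
        unfolding D2 e_def using p1 by algebra
      have d: "2 * ((p 0 - q 0) * p 0 + (p 1 - q 1) * p 1) = D\<^sup>2"
        unfolding D2 using p1 q1 by algebra
      then have "(p 0 - q 0) * p 0 + (p 1 - q 1) * p 1 > 0" using D0 by (smt (verit) zero_less_power)
      then show ?thesis using e by (smt (verit) zero_less_power)
    qed
    then have "\<bar>e\<bar> < D" using D0 by (metis abs_le_square_iff abs_of_pos linorder_not_less)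
    moreover have "L \<nu> = D - e"
    proof -
      have "L \<nu> = ((p 0 - q 0)\<^sup>2 + (p 1 - q 1)\<^sup>2) / D - e"
        using D0 by (simp add: L_def \<nu>_def e_def field_simps power2_eq_square)
      also have "\<dots> = D\<^sup>2 / D - e" by (simp only: D2)
      finally show ?thesis using D0 by (simp add: power2_eq_square)
    qed
    moreover have "L (\<lambda>i. - \<nu> i) = - D - e"
    proof -
      have "L (\<lambda>i. - \<nu> i) = - L \<nu> - 2 * e"
        by (simp add: L_def e_def algebra_simps)
      then show ?thesis using \<open>L \<nu> = D - e\<close> by simp
    qed
    ultimately have signs: "L \<nu> > 0" "L (\<lambda>i. - \<nu> i) < 0" by linarith+
    have Lpq: "L p = 0" "L q = 0" by (simp_all add: L_def algebra_simps)
    \<comment> \<open>A point of the line is \<open>p + s (q - p)\<close>, and the equation of the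
      circle reduces to \<open>s (s - 1) = 0\<close>.\<close>
    have zero: "x = p \<or> x = q" if x: "x \<in> C" "L x = 0" for x
    proof -
      have x1: "(x 0)\<^sup>2 + (x 1)\<^sup>2 = 1" using x C_iff by blast
      have par: "(p 1 - q 1) * (x 0 - p 0) = (p 0 - q 0) * (x 1 - p 1)"
        using x(2) by (simp add: L_def)
      define s where "s = ((x 0 - p 0) * (q 0 - p 0) + (x 1 - p 1) * (q 1 - p 1)) / D\<^sup>2"
      have sD: "s * D\<^sup>2 = (x 0 - p 0) * (q 0 - p 0) + (x 1 - p 1) * (q 1 - p 1)"
        using D0 by (simp add: s_def)
      have "D\<^sup>2 * (x 0 - p 0) = D\<^sup>2 * (s * (q 0 - p 0))"
        using par sD unfolding D2 by algebra
      then have x0: "x 0 = p 0 + s * (q 0 - p 0)" using D0 by simp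
      have "D\<^sup>2 * (x 1 - p 1) = D\<^sup>2 * (s * (q 1 - p 1))"
        using par sD unfolding D2 by algebra
      then have x1': "x 1 = p 1 + s * (q 1 - p 1)" using D0 by simp
      have "s * (s - 1) * D\<^sup>2 = 0"
        using x1 p1 q1 unfolding x0 x1' D2 by algebra
      then have "s = 0 \<or> s = 1" using D0 by auto
      then show ?thesis using x0 x1' ext[OF x(1) p] ext[OF x(1) q] by auto
    qed
    have opn: "open {x. L x > 0}" "open {x. L x < 0}"
      by (auto intro!: open_Collect_less Lcont continuous_intros)
    have "C - {p, q} \<subseteq> {x. L x > 0} \<union> {x. L x < 0}" using zero by force
    moreover have "{x. L x > 0} \<inter> {x. L x < 0} \<inter> (C - {p, q}) = {}" by auto
    ultimately have "{x. L x > 0} \<inter> (C - {p, q}) = {} \<or> {x. L x < 0} \<inter> (C - {p, q}) = {}"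
      using connectedD[OF con opn] by blast
    then show False using \<nu>C signs Lpq by force
  qed
  have "\<gamma> 0 0 \<noteq> \<gamma> pi 0" by (simp add: \<gamma>_def)
  then show "\<exists>p\<in>C. \<exists>q\<in>C. p \<noteq> q" using \<gamma>C by metis
qed

lemma homeomorphic_circle_facts:
  fixes T :: "('a \<Rightarrow> real) set"
  assumes "nsphere 1 homeomorphic_space top_of_set T"
  shows "connected T" "p \<in> T \<Longrightarrow> connected (T - {p})"
    "p \<in> T \<Longrightarrow> q \<in> T \<Longrightarrow> p \<noteq> q \<Longrightarrow> \<not> connected (T - {p, q})"
    "\<exists>p\<in>T. \<exists>q\<in>T. p \<noteq> q"
proof -
  define C where "C = {x :: nat \<Rightarrow> real. (\<Sum>i\<le>1. (x i)\<^sup>2) = 1 \<and> (\<forall>i>1. x i = 0)}"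
  note cf = circle_facts[folded C_def]
  have "nsphere 1 = top_of_set C" unfolding nsphere C_def realisation_topology ..
  then obtain f g where fg: "homeomorphic_maps (top_of_set C) (top_of_set T) f g"
    using assms by (auto simp: homeomorphic_space_def)
  have cf': "continuous_on C f" "continuous_on T g" "f ` C \<subseteq> T" "g ` T \<subseteq> C"
    "\<And>x. x \<in> C \<Longrightarrow> g (f x) = x" "\<And>y. y \<in> T \<Longrightarrow> f (g y) = y"
    using fg by (auto simp: homeomorphic_maps_def)
  have f_im: "f ` (C - g ` S) = T - S" if "S \<subseteq> T" for S
  proof (intro equalityI subsetI)
    fix y assume "y \<in> f ` (C - g ` S)"
    then show "y \<in> T - S" using cf' that by force
  next
    fix y assume y: "y \<in> T - S"
    have "g y \<notin> g ` S" using y that cf'(6) by (metis DiffE imageE subsetD)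
    then show "y \<in> f ` (C - g ` S)" using y cf' by (intro image_eqI[of _ _ "g y"]) auto
  qed
  have g_im: "g ` (T - S) = C - g ` S" if "S \<subseteq> T" for S
  proof -
    have "g ` f ` (C - g ` S) = id ` (C - g ` S)"
      unfolding image_image by (rule image_cong) (simp_all add: cf'(5))
    then show ?thesis by (simp add: f_im[OF that])
  qed
  have iff: "connected (T - S) \<longleftrightarrow> connected (C - g ` S)" if "S \<subseteq> T" for S
    using f_im[OF that] g_im[OF that] cf'(1,2)
    by (metis Diff_subset connected_continuous_image continuous_on_subset)
  show "connected T" using iff[of "{}"] cf(1) by simp
  show "connected (T - {p})" if "p \<in> T"
    using iff[of "{p}"] cf(2)[of "g p"] that cf' by auto
  show "\<not> connected (T - {p, q})" if "p \<in> T" "q \<in> T" "p \<noteq> q"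
  proof -
    have "g p \<noteq> g q" using that cf'(6) by metis
    then show ?thesis using iff[of "{p, q}"] cf(3)[of "g p" "g q"] that cf' by auto
  qed
  obtain x y where "x \<in> C" "y \<in> C" "x \<noteq> y" using cf(4) by blast
  then show "\<exists>p\<in>T. \<exists>q\<in>T. p \<noteq> q" using cf' by (metis image_subset_iff)
qed

section \<open>Segments in barycentric coordinates\<close>

definition point_mass :: "'a \<Rightarrow> 'a \<Rightarrow> real" where
  "point_mass v = (\<lambda>x. if x = v then 1 else 0)"

definition seg :: "('a \<Rightarrow> real) \<Rightarrow> ('a \<Rightarrow> real) \<Rightarrow> real \<Rightarrow> 'a \<Rightarrow> real" where
  "seg t u s = (\<lambda>x. (1 - s) * t x + s * u x)"

lemma seg_01 [simp]: "seg t u 0 = t" "seg t u 1 = u"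
  by (simp_all add: seg_def)

lemma connected_component_seg:
  assumes "\<And>s. 0 \<le> s \<Longrightarrow> s \<le> 1 \<Longrightarrow> seg t u s \<in> S"
  shows "connected_component S t u"
  unfolding connected_component_def
proof (intro exI conjI)
  have "continuous_on {0..1} (seg t u)"
    unfolding seg_def
    by (rule continuous_on_coordinatewise_then_product) (intro continuous_intros)
  then show "connected (seg t u ` {0..1})" by (intro connected_continuous_image) auto
  show "seg t u ` {0..1} \<subseteq> S" using assms by auto
  show "t \<in> seg t u ` {0..1}" "u \<in> seg t u ` {0..1}"
    by (rule image_eqI[of _ _ 0]; simp) (rule image_eqI[of _ _ 1]; simp)
qed

text \<open>Collects the link between arcs and simplices and the topological properties of the
  circle. The latter are contradicted below by showing that a forbidden configuration has a cut
  point or a pair of points that does not cut.\<close>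

locale circle_complex =
  fixes V :: "'a set" and A :: "'a rel" and K :: "'a set set" and T :: "('a \<Rightarrow> real) set"
  assumes finite_V: "finite V"
    and V_nonempty: "V \<noteq> {}"
    and A_sub: "A \<subseteq> V \<times> V"
    and A_refl: "v \<in> V \<Longrightarrow> (v, v) \<in> A"
    and K_sub: "S \<in> K \<Longrightarrow> S \<subseteq> V"
    and K_vertex: "v \<in> V \<Longrightarrow> {v} \<in> K"
    and K_edge: "adjacent A a b \<Longrightarrow> {a, b} \<in> K"
    and K_adjacent: "S \<in> K \<Longrightarrow> a \<in> S \<Longrightarrow> b \<in> S \<Longrightarrow> a \<noteq> b \<Longrightarrow> adjacent A a b"
    and K_triangle: "(a, b) \<in> A \<Longrightarrow> (b, c) \<in> A \<Longrightarrow> (a, c) \<in> A \<Longrightarrow> {a, b, c} \<in> K"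
    and T_eq: "T = {t. (\<forall>v. 0 \<le> t v) \<and> {v. t v \<noteq> 0} \<in> K \<and> (\<Sum>v | t v \<noteq> 0. t v) = 1}"
    and conn: "connected T"
    and conn1: "p \<in> T \<Longrightarrow> connected (T - {p})"
    and disconn2: "p \<in> T \<Longrightarrow> q \<in> T \<Longrightarrow> p \<noteq> q \<Longrightarrow> \<not> connected (T - {p, q})"
    and two_points: "\<exists>p\<in>T. \<exists>q\<in>T. p \<noteq> q"
begin

lemma adjacent_V: "adjacent A a b \<Longrightarrow> a \<in> V \<and> b \<in> V"
  using A_sub by (auto simp: adjacent_def)

lemma sum_support: "{v. t v \<noteq> 0} \<subseteq> V \<Longrightarrow> (\<Sum>v | t v \<noteq> 0. t v) = sum t V"
  by (rule sum.mono_neutral_left) (use finite_V in auto)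

lemma TI: "(\<And>v. 0 \<le> t v) \<Longrightarrow> {v. t v \<noteq> 0} = S \<Longrightarrow> S \<in> K \<Longrightarrow> sum t V = 1 \<Longrightarrow> t \<in> T"
  unfolding T_eq using sum_support[of t] K_sub by auto

lemma TD:
  assumes "t \<in> T"
  shows "0 \<le> t v" "{v. t v \<noteq> 0} \<in> K" "{v. t v \<noteq> 0} \<subseteq> V" "sum t V = 1"
proof -
  show "0 \<le> t v" and K: "{v. t v \<noteq> 0} \<in> K" using assms by (auto simp: T_eq)
  show "{v. t v \<noteq> 0} \<subseteq> V" using K by (rule K_sub)
  then show "sum t V = 1" using assms sum_support[of t] by (auto simp: T_eq)
qed

lemma T_support_nonempty: "t \<in> T \<Longrightarrow> \<exists>w\<in>V. t w \<noteq> 0"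
  using TD(4)[of t] by (metis sum.neutral zero_neq_one)

lemma sum_point_mass: "v \<in> V \<Longrightarrow> sum (point_mass v) V = 1"
  using finite_V by (simp add: point_mass_def)

lemma sum_seg: "sum (seg t u s) V = (1 - s) * sum t V + s * sum u V"
  by (simp add: seg_def sum.distrib sum_distrib_left)

lemma support_point_mass: "{x. point_mass v x \<noteq> 0} = {v}"
  by (auto simp: point_mass_def)

lemma point_mass_in_T: "v \<in> V \<Longrightarrow> point_mass v \<in> T"
  by (rule TI[OF _ support_point_mass])
    (auto simp: point_mass_def K_vertex sum_point_mass[unfolded point_mass_def])

text \<open>Moving towards a vertex of its own support keeps a point in the interior of its simplex
  until the endpoint is reached.\<close>

lemma support_seg_vertex:
  assumes "t \<in> T" "t w \<noteq> 0" "0 \<le> s" "s < 1"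
  shows "{x. seg t (point_mass w) s x \<noteq> 0} = {x. t x \<noteq> 0}"
proof (rule Collect_cong)
  fix x
  have "(1 - s) * t x > 0 \<longleftrightarrow> t x \<noteq> 0"
    using TD(1)[OF assms(1), of x] assms(4) by (simp add: zero_less_mult_iff less_le)
  moreover have "(1 - s) * t w > 0"
    using TD(1)[OF assms(1), of w] assms by (simp add: zero_less_mult_iff less_le)
  ultimately show "(seg t (point_mass w) s x \<noteq> 0) = (t x \<noteq> 0)"
    using assms by (cases "x = w") (auto simp: seg_def point_mass_def)
qed

lemma seg_vertex_in_T:
  assumes t: "t \<in> T" and w: "t w \<noteq> 0" and s: "0 \<le> s" "s \<le> 1"
  shows "seg t (point_mass w) s \<in> T"
proof (cases "s = 1")
  case True
  have "w \<in> V" using TD(3)[OF t] w by blast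
  then show ?thesis using True point_mass_in_T by simp
next
  case False
  then have "{x. seg t (point_mass w) s x \<noteq> 0} = {x. t x \<noteq> 0}"
    using support_seg_vertex t w s by simp
  then show ?thesis
  proof (rule TI[rotated])
    show "0 \<le> seg t (point_mass w) s v" for v
      using TD(1)[OF t, of v] s by (simp add: seg_def point_mass_def)
    have "w \<in> V" using TD(3)[OF t] w by blast
    then show "sum (seg t (point_mass w) s) V = 1"
      by (simp add: sum_seg TD(4)[OF t] sum_point_mass)
  qed (rule TD(2)[OF t])
qed

lemma support_edge:
  assumes "a \<noteq> b" "0 < s" "s < 1"
  shows "{x. seg (point_mass a) (point_mass b) s x \<noteq> 0} = {a, b}"
  using assms by (auto simp: seg_def point_mass_def)

lemma edge_in_T:
  assumes ab: "adjacent A a b" and s: "0 \<le> s" "s \<le> 1"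
  shows "seg (point_mass a) (point_mass b) s \<in> T"
proof (cases "s = 0 \<or> s = 1")
  case True
  then show ?thesis using adjacent_V[OF ab] point_mass_in_T by auto
next
  case False
  have "a \<noteq> b" using ab by (simp add: adjacent_def)
  then have "{x. seg (point_mass a) (point_mass b) s x \<noteq> 0} = {a, b}"
    using False s by (intro support_edge) auto
  then show ?thesis
    by (rule TI[rotated])
      (use s adjacent_V[OF ab] in \<open>auto simp: K_edge[OF ab] sum_seg sum_point_mass, simp add: seg_def point_mass_def\<close>)
qed

text \<open>If no edge joined the two parts, then the points with mass on the one part and the points with
  mass on the other would separate the realisation.\<close>

lemma edge_across_cut:
  assumes con: "connected (T - point_mass ` Z)"
    and XY: "X \<union> Y = V - Z" "X \<inter> Y = {}" "X \<noteq> {}" "Y \<noteq> {}"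
    and Z: "\<And>t. t \<in> T \<Longrightarrow> {v. t v \<noteq> 0} \<subseteq> Z \<Longrightarrow> t \<in> point_mass ` Z"
  shows "\<exists>x\<in>X. \<exists>y\<in>Y. adjacent A x y"
proof (rule ccontr)
  assume no: "\<not> ?thesis"
  define U :: "'a set \<Rightarrow> ('a \<Rightarrow> real) set" where "U = (\<lambda>S. \<Union>a\<in>S. {t. 0 < t a})"
  have op: "open (U S)" for S
    unfolding U_def
    by (intro open_UN ballI open_Collect_less continuous_intros continuous_on_product_coordinates)
  have pm: "point_mass a \<in> U S \<inter> (T - point_mass ` Z)" if "a \<in> S" "a \<in> V" "a \<notin> Z" for a S
  proof -
    have "point_mass a \<noteq> (point_mass z :: 'a \<Rightarrow> real)" if "z \<in> Z" for z
    proof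
      assume "point_mass a = (point_mass z :: 'a \<Rightarrow> real)"
      from fun_cong[OF this, of a] show False
        using \<open>a \<notin> Z\<close> that by (auto simp: point_mass_def split: if_splits)
    qed
    moreover have "point_mass a \<in> U S" using that by (auto simp: U_def point_mass_def)
    ultimately show ?thesis using point_mass_in_T[OF that(2)] by blast
  qed
  have "U X \<inter> U Y \<inter> (T - point_mass ` Z) = {}"
  proof (rule ccontr)
    assume "\<not> ?thesis"
    then obtain t a b where t: "t \<in> T" "a \<in> X" "b \<in> Y" "0 < t a" "0 < t b" by (auto simp: U_def)
    then have "adjacent A a b" using K_adjacent[OF TD(2)[OF t(1)], of a b] XY by auto
    then show False using no t by blast
  qed
  moreover have "T - point_mass ` Z \<subseteq> U X \<union> U Y"
  proof
    fix t assume t: "t \<in> T - point_mass ` Z"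
    then obtain v where "t v \<noteq> 0" "v \<notin> Z" using Z by blast
    then have "v \<in> X \<union> Y" "0 < t v" using TD(1,3)[of t] t XY by (auto simp: less_le)
    then show "t \<in> U X \<union> U Y" by (auto simp: U_def)
  qed
  ultimately have "U X \<inter> (T - point_mass ` Z) = {} \<or> U Y \<inter> (T - point_mass ` Z) = {}"
    using connectedD[OF con op op] by blast
  then show False using pm XY by blast
qed

section \<open>From connectedness of the realisation to the structure of the graph\<close>

lemma graph_connected:
  assumes "S \<subseteq> V" "S \<noteq> {}" "S \<noteq> V"
  shows "\<exists>x\<in>S. \<exists>y\<in>V - S. adjacent A x y"
  by (rule edge_across_cut[of "{}"]) (use conn assms T_support_nonempty in auto)

text \<open>A cut vertex of the graph would be a cut point of the realisation.\<close>

lemma graph_connected_minus: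
  assumes "v \<in> V" "X \<subseteq> V - {v}" "X \<noteq> {}" "X \<noteq> V - {v}"
  shows "\<exists>x\<in>X. \<exists>y\<in>V - {v} - X. adjacent A x y"
proof (rule edge_across_cut[of "{v}"])
  fix t assume t: "t \<in> T" "{w. t w \<noteq> 0} \<subseteq> {v}"
  then have "sum t V = sum t {v}"
    by (intro sum.mono_neutral_right) (use finite_V assms in auto)
  then have "t v = 1" using TD(4)[OF t(1)] by simp
  then have "t = point_mass v" using t(2) by (auto simp: point_mass_def fun_eq_iff)
  then show "t \<in> point_mass ` {v}" by simp
qed (use conn1[OF point_mass_in_T[OF assms(1)]] assms in auto)

lemma connected_punctured:
  assumes seg: "\<And>t. t \<in> T - P \<Longrightarrow>
      \<exists>w\<in>V. \<forall>s. 0 \<le> s \<and> s \<le> 1 \<longrightarrow> seg t (point_mass w) s \<in> T - P"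
    and vert: "\<And>w. w \<in> V \<Longrightarrow> connected_component (T - P) (point_mass v) (point_mass w)"
  shows "connected (T - P)"
proof -
  have "connected_component (T - P) (point_mass v) t" if t: "t \<in> T - P" for t
  proof -
    obtain w where w: "w \<in> V" "\<forall>s. 0 \<le> s \<and> s \<le> 1 \<longrightarrow> seg t (point_mass w) s \<in> T - P"
      using seg[OF t] by blast
    then have "connected_component (T - P) t (point_mass w)"
      by (intro connected_component_seg) auto
    then show ?thesis using vert[OF w(1)] connected_component_sym connected_component_trans by metis
  qed
  then show ?thesis
    unfolding connected_iff_connected_component
    by (meson connected_component_sym connected_component_trans)
qed

text \<open>If \<open>p\<close> lies strictly between \<open>t\<close> and the vertex
  \<open>w\<close>, all positive coordinates of \<open>p\<close> other than that at \<open>w\<close>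
  are smaller than those of \<open>t\<close>. A point that blocks two vertices would thus have too
  small a coordinate sum.\<close>

lemma blocked_segment:
  assumes "0 \<le> s" "s \<le> 1" "seg t (point_mass w) s = p" "t \<noteq> p" "p \<noteq> point_mass w" "x \<noteq> w" "0 < p x"
  shows "p x < t x"
proof -
  have "s \<noteq> 0" "s \<noteq> 1" using assms by auto
  then have s: "0 < s" "s < 1" using assms by auto
  have px: "p x = (1 - s) * t x" using assms(3,6) by (auto simp: seg_def point_mass_def)
  then have "t x > 0" using assms(7) s by (simp add: zero_less_mult_iff)
  then have "(1 - s) * t x < 1 * t x" using s by (intro mult_strict_right_mono) auto
  then show ?thesis using px by simp
qed

text \<open>Such a triangle spans a 2-simplex, and removing two of its interior points does not
  disconnect the realisation: every remaining point sees a vertex, and the edges of the graph avoid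
  the interior.\<close>

lemma no_transitive_triangle:
  assumes A: "(a, b) \<in> A" "(b, c) \<in> A" "(a, c) \<in> A"
  shows "a = b \<or> b = c \<or> a = c"
proof (rule ccontr)
  assume "\<not> ?thesis"
  then have ne: "a \<noteq> b" "b \<noteq> c" "a \<noteq> c" by auto
  have V: "a \<in> V" "b \<in> V" "c \<in> V" using A A_sub by auto
  define \<pi> :: "real \<Rightarrow> 'a \<Rightarrow> real" where
    "\<pi> = (\<lambda>r x. if x = a then r else if x = b \<or> x = c then (1 - r) / 2 else 0)"
  have supp: "{x. \<pi> r x \<noteq> 0} = {a, b, c}" if "0 < r" "r < 1" for r
    using that ne by (auto simp: \<pi>_def)
  have sum3: "sum t V = t a + t b + t c" if "{x. t x \<noteq> 0} \<subseteq> {a, b, c}" for t :: "'a \<Rightarrow> real"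
  proof -
    have "sum t V = sum t {a, b, c}"
      by (rule sum.mono_neutral_right) (use that V finite_V in auto)
    then show ?thesis using ne by simp
  qed
  have \<pi>T: "\<pi> r \<in> T" if r: "0 < r" "r < 1" for r
  proof (rule TI[OF _ supp[OF r] K_triangle[OF A]])
    show "0 \<le> \<pi> r v" for v using r by (simp add: \<pi>_def)
    show "sum (\<pi> r) V = 1" using sum3[of "\<pi> r"] supp[OF r] ne by (simp add: \<pi>_def field_simps)
  qed
  define p q where "p = \<pi> (1/3)" and "q = \<pi> (1/2)"
  have pq: "p \<in> T" "q \<in> T" "{x. p x \<noteq> 0} = {a, b, c}" "{x. q x \<noteq> 0} = {a, b, c}" "p \<noteq> q"
    using \<pi>T supp by (auto simp: p_def q_def \<pi>_def dest: fun_cong[of _ _ a])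
  have small: "t \<notin> {p, q}" if "{x. t x \<noteq> 0} \<noteq> {a, b, c}" for t using that pq by auto
  have "connected (T - {p, q})"
  proof (rule connected_punctured)
    fix t assume t: "t \<in> T - {p, q}"
    show "\<exists>w\<in>V. \<forall>s. 0 \<le> s \<and> s \<le> 1 \<longrightarrow> seg t (point_mass w) s \<in> T - {p, q}"
    proof (cases "{x. t x \<noteq> 0} = {a, b, c}")
      case False
      obtain w where w: "w \<in> V" "t w \<noteq> 0" using T_support_nonempty t by blast
      have "seg t (point_mass w) s \<in> T - {p, q}" if s: "0 \<le> s" "s \<le> 1" for s
      proof -
        have "{x. seg t (point_mass w) s x \<noteq> 0} \<noteq> {a, b, c}"
          using support_seg_vertex[of t w s] support_point_mass[of w] False t w(2) s ne
          by (cases "s = 1") auto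
        then show ?thesis using small seg_vertex_in_T[of t w s] t w(2) s by auto
      qed
      then show ?thesis using w by blast
    next
      case True
      text \<open>Each of \<open>p\<close>, \<open>q\<close> blocks the view from \<open>t\<close> to at most one of the three vertices.\<close>
      define blk where "blk = (\<lambda>r w. \<exists>s. 0 \<le> s \<and> s \<le> 1 \<and> seg t (point_mass w) s = r)"
      have sum_t: "t a + t b + t c = 1" using sum3[of t] True TD(4)[of t] t by auto
      have one: "w = w'" if "r \<in> {p, q}" "blk r w" "blk r w'" for r w w'
      proof (rule ccontr)
        assume "w \<noteq> w'"
        have r: "r \<in> T" "{x. r x \<noteq> 0} = {a, b, c}" "t \<noteq> r" using that(1) pq t by auto
        have "r \<noteq> point_mass w" "r \<noteq> point_mass w'"
          using r(2) support_point_mass[of w] support_point_mass[of w'] ne by auto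
        then have "r x < t x" if "x \<in> {a, b, c}" for x
        proof -
          have "0 < r x" using r that TD(1)[OF r(1), of x] by (auto simp: less_le)
          moreover have "x \<noteq> w \<or> x \<noteq> w'" using \<open>w \<noteq> w'\<close> by auto
          ultimately show ?thesis
            using blocked_segment[of _ t w r x] blocked_segment[of _ t w' r x] r(3)
              \<open>blk r w\<close> \<open>blk r w'\<close> \<open>r \<noteq> point_mass w\<close> \<open>r \<noteq> point_mass w'\<close>
            unfolding blk_def by blast
        qed
        then have "r a + r b + r c < t a + t b + t c" by (intro add_strict_mono) auto
        then show False using sum_t sum3[of r] r(2) TD(4)[OF r(1)] by auto
      qed
      have "\<exists>w\<in>{a, b, c}. \<not> blk p w \<and> \<not> blk q w" using one[of p] one[of q] ne by blast
      then obtain w where w: "w \<in> {a, b, c}" "\<not> blk p w" "\<not> blk q w" by blast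
      have "t w \<noteq> 0" using True w(1) by blast
      then have "seg t (point_mass w) s \<in> T - {p, q}" if "0 \<le> s" "s \<le> 1" for s
        using seg_vertex_in_T[of t w s] t that w(2,3) unfolding blk_def by auto
      moreover have "w \<in> V" using w(1) V by auto
      ultimately show ?thesis by blast
    qed
  next
    fix w assume w: "w \<in> V"
    let ?S = "{x \<in> V. connected_component (T - {p, q}) (point_mass a) (point_mass x)}"
    have edge: "connected_component (T - {p, q}) (point_mass x) (point_mass y)"
      if "adjacent A x y" for x y
    proof (rule connected_component_seg)
      fix s :: real assume s: "0 \<le> s" "s \<le> 1"
      have "x \<noteq> y" using that by (simp add: adjacent_def)
      have "{v. seg (point_mass x) (point_mass y) s v \<noteq> 0} \<noteq> {a, b, c}"
      proof -
        have "\<not> {a, b, c} \<subseteq> {x, y}" using ne by auto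
        moreover have "{v. seg (point_mass x) (point_mass y) s v \<noteq> 0} \<subseteq> {x, y}"
          by (auto simp: seg_def point_mass_def split: if_splits)
        ultimately show ?thesis by blast
      qed
      then show "seg (point_mass x) (point_mass y) s \<in> T - {p, q}"
        using small edge_in_T[OF that s] by blast
    qed
    have "a \<in> ?S" using V point_mass_in_T small support_point_mass[of a] ne
      by (auto simp: connected_component_refl_eq)
    moreover have False if "x \<in> ?S" "y \<in> V - ?S" "adjacent A x y" for x y
      using that edge[OF that(3)] connected_component_trans by blast
    ultimately have "?S = V" using graph_connected[of ?S] by blast
    then show "connected_component (T - {p, q}) (point_mass a) (point_mass w)" using w by blast
  qed
  then show False using disconn2 pq by blast
qed

lemma at_least_one_neighbour:
  assumes v: "v \<in> V"
  shows "\<exists>w. adjacent A v w"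
proof -
  have "V \<noteq> {v}"
  proof
    assume V: "V = {v}"
    have "t = point_mass v" if "t \<in> T" for t
    proof
      fix x
      show "t x = point_mass v x" using TD(3,4)[OF that] V by (auto simp: point_mass_def)
    qed
    then show False using two_points by metis
  qed
  then show ?thesis using graph_connected[of "{v}"] v by blast
qed

text \<open>With a single neighbour \<open>w\<close>, the midpoint of the edge is the only point
  whose coordinate at \<open>v\<close> is \<open>1/2\<close>, so this coordinate shows it to be a
  cut point.\<close>

lemma second_neighbour:
  assumes vw: "adjacent A v w"
  shows "\<exists>w'. w' \<noteq> w \<and> adjacent A v w'"
proof (rule ccontr)
  assume "\<not> ?thesis"
  then have only: "x = w" if "adjacent A v x" for x using that by blast
  have ne: "v \<noteq> w" and V: "v \<in> V" "w \<in> V" using vw adjacent_V by (auto simp: adjacent_def)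
  define p where "p = seg (point_mass v) (point_mass w) (1/2)"
  have p: "p \<in> T" unfolding p_def using vw by (intro edge_in_T) auto
  have mid: "t = p" if t: "t \<in> T" "t v = 1/2" for t
  proof -
    have supp: "{x. t x \<noteq> 0} \<subseteq> {v, w}"
      using K_adjacent[OF TD(2)[OF t(1)], of v] t(2) only by force
    have "sum t V = sum t {v, w}"
      by (rule sum.mono_neutral_right) (use supp V finite_V in auto)
    then have "t w = 1/2" using TD(4)[OF t(1)] ne t(2) by simp
    then show ?thesis using supp t(2) ne by (auto simp: fun_eq_iff p_def seg_def point_mass_def)
  qed
  have op: "open {t :: 'a \<Rightarrow> real. t v < 1/2}" "open {t :: 'a \<Rightarrow> real. 1/2 < t v}"
    by (intro open_Collect_less continuous_intros continuous_on_product_coordinates)+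
  have cover: "T - {p} \<subseteq> {t. t v < 1/2} \<union> {t. 1/2 < t v}" using mid by force
  have disj: "{t. t v < 1/2} \<inter> {t. 1/2 < t v} \<inter> (T - {p}) = {}" by auto
  have pv: "p v = 1/2" using ne by (simp add: p_def seg_def point_mass_def)
  have "point_mass w \<in> {t. t v < 1/2} \<inter> (T - {p})" "point_mass v \<in> {t. 1/2 < t v} \<inter> (T - {p})"
    using point_mass_in_T V ne pv by (auto simp: point_mass_def)
  then show False using connectedD[OF conn1[OF p] op disj cover] by blast
qed

text \<open>With a third neighbour \<open>c\<close>, the midpoints of the edges to \<open>a\<close>
  and \<open>b\<close> do not disconnect: the other vertices are joined without \<open>v\<close> by
  \<open>graph_connected_minus\<close>, and \<open>v\<close> is joined to them through
  \<open>c\<close>.\<close>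

lemma at_most_two_neighbours:
  assumes adj: "adjacent A v a" "adjacent A v b" "adjacent A v c"
  shows "a = b \<or> b = c \<or> a = c"
proof (rule ccontr)
  assume "\<not> ?thesis"
  then have ne: "a \<noteq> b" "b \<noteq> c" "a \<noteq> c" by auto
  have va: "v \<noteq> a" "v \<noteq> b" "v \<noteq> c" using adj by (auto simp: adjacent_def)
  have V: "v \<in> V" "a \<in> V" "b \<in> V" "c \<in> V" using adj adjacent_V by auto
  define mid :: "'a \<Rightarrow> 'a \<Rightarrow> real" where "mid = (\<lambda>x. seg (point_mass v) (point_mass x) (1/2))"
  have midT: "mid a \<in> T" "mid b \<in> T" unfolding mid_def using adj by (auto intro!: edge_in_T)
  have mid_supp: "{x. mid a x \<noteq> 0} = {v, a}" "{x. mid b x \<noteq> 0} = {v, b}"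
    unfolding mid_def using va by (simp_all add: support_edge)
  have mid_v: "mid a v = 1/2" "mid b v = 1/2" using va by (auto simp: mid_def seg_def point_mass_def)
  let ?P = "{mid a, mid b}"
  have small: "t \<notin> ?P" if "{x. t x \<noteq> 0} \<noteq> {v, a}" "{x. t x \<noteq> 0} \<noteq> {v, b}" for t
    using that mid_supp by auto
  have half: "t \<notin> ?P" if "t v \<noteq> 1/2" for t using that mid_v by auto
  have pm: "point_mass x \<in> T - ?P" if "x \<in> V" for x
    using half[of "point_mass x"] point_mass_in_T[OF that] by (auto simp: point_mass_def)
  have "connected (T - ?P)"
  proof (rule connected_punctured)
    fix t assume t: "t \<in> T - ?P"
    \<comment> \<open>A point inside a punctured edge moves to the end on its own side of the
      midpoint; any other point moves to a vertex of its support.\<close>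
    show "\<exists>w\<in>V. \<forall>s. 0 \<le> s \<and> s \<le> 1 \<longrightarrow> seg t (point_mass w) s \<in> T - ?P"
    proof (cases "\<exists>x\<in>{a, b}. {y. t y \<noteq> 0} = {v, x}")
      case False
      obtain w where w: "w \<in> V" "t w \<noteq> 0" using T_support_nonempty t by blast
      have "seg t (point_mass w) s \<in> T - ?P" if s: "0 \<le> s" "s \<le> 1" for s
      proof (cases "s = 1")
        case True
        then show ?thesis using pm w(1) by simp
      next
        case s1: False
        then have "{x. seg t (point_mass w) s x \<noteq> 0} = {x. t x \<noteq> 0}"
          using support_seg_vertex[of t w s] t w(2) s by simp
        then show ?thesis using small[of "seg t (point_mass w) s"] False
            seg_vertex_in_T[of t w s] t w(2) s by auto
      qed
      then show ?thesis using w by blast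
    next
      case True
      then obtain x where x: "x \<in> {a, b}" "{y. t y \<noteq> 0} = {v, x}" by blast
      have xV: "x \<in> V" "x \<noteq> v" using x(1) V va by auto
      have "sum t V = sum t {v, x}"
        by (rule sum.mono_neutral_right) (use x(2) V xV finite_V in auto)
      then have tx: "t v + t x = 1" using TD(4)[of t] t xV by auto
      have "t v \<noteq> 1/2"
      proof
        assume tv: "t v = 1/2"
        have "t = mid x"
        proof
          fix y
          show "t y = mid x y" using tv tx x(2) xV
            by (cases "y = v"; cases "y = x") (auto simp: mid_def seg_def point_mass_def)
        qed
        then show False using t x(1) by auto
      qed
      then consider "t v > 1/2" | "t v < 1/2" by linarith
      then show ?thesis
      proof cases
        case 1
        have "seg t (point_mass v) s \<in> T - ?P" if s: "0 \<le> s" "s \<le> 1" for s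
        proof -
          have "(1 - s) * t v \<ge> (1 - s) * (1/2)" using 1 s by (intro mult_left_mono) auto
          moreover have "(1 - s) * t v > (1 - s) * (1/2)" if "s < 1" using 1 that by simp
          ultimately have "seg t (point_mass v) s v > 1/2"
            using s by (cases "s = 1") (auto simp: seg_def point_mass_def field_simps)
          then show ?thesis using half seg_vertex_in_T[of t v s] t s 1 by force
        qed
        then show ?thesis using V by blast
      next
        case 2
        have "t x \<noteq> 0" using tx 2 by auto
        have "seg t (point_mass x) s \<in> T - ?P" if s: "0 \<le> s" "s \<le> 1" for s
        proof -
          have "(1 - s) * t v \<le> 1 * t v" using s TD(1)[of t v] t by (intro mult_right_mono) auto
          then have "seg t (point_mass x) s v < 1/2"
            using 2 xV by (auto simp: seg_def point_mass_def)
          then show ?thesis using half seg_vertex_in_T[of t x s] t s \<open>t x \<noteq> 0\<close> by force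
        qed
        then show ?thesis using xV by blast
      qed
    qed
  next
    fix w assume w: "w \<in> V"
    let ?S = "{x \<in> V - {v}. connected_component (T - ?P) (point_mass c) (point_mass x)}"
    have edge: "connected_component (T - ?P) (point_mass x) (point_mass y)"
      if xy: "adjacent A x y" "x \<noteq> v" "y \<noteq> v \<or> x = c" for x y
    proof (rule connected_component_seg)
      fix s :: real assume s: "0 \<le> s" "s \<le> 1"
      have "x \<noteq> y" using that by (simp add: adjacent_def)
      show "seg (point_mass x) (point_mass y) s \<in> T - ?P"
      proof (cases "s = 0 \<or> s = 1")
        case True
        then show ?thesis using pm adjacent_V[OF xy(1)] by auto
      next
        case False
        then have "{z. seg (point_mass x) (point_mass y) s z \<noteq> 0} = {x, y}"
          using s \<open>x \<noteq> y\<close> by (intro support_edge) auto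
        moreover have "{x, y} \<noteq> {v, a}" "{x, y} \<noteq> {v, b}" using xy ne by (auto simp: doubleton_eq_iff)
        ultimately show ?thesis using small edge_in_T[OF xy(1) s] by simp
      qed
    qed
    have "c \<in> ?S" using V va pm[of c] by (auto simp: connected_component_refl_eq)
    moreover have False if "x \<in> ?S" "y \<in> V - {v} - ?S" "adjacent A x y" for x y
    proof -
      have "connected_component (T - ?P) (point_mass x) (point_mass y)" using that by (intro edge) auto
      then show False using that connected_component_trans by blast
    qed
    ultimately have "?S = V - {v}" using graph_connected_minus[OF V(1), of ?S] by blast
    moreover have "connected_component (T - ?P) (point_mass c) (point_mass v)"
      using edge[of c v] adjacent_sym[OF adj(3)] va by simp
    ultimately show "connected_component (T - ?P) (point_mass c) (point_mass w)"
      using w by (cases "w = v") auto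
  qed
  moreover have "mid a \<noteq> mid b" using mid_supp ne va by (auto simp: doubleton_eq_iff)
  ultimately show False using disconn2 midT by blast
qed

lemma circle_digraph: "circle_digraph V A"
proof
  show "\<exists>a b. a \<noteq> b \<and> {w. adjacent A v w} = {a, b}" if v: "v \<in> V" for v
  proof -
    obtain a b where "adjacent A v a" "adjacent A v b" "a \<noteq> b"
      using at_least_one_neighbour[OF v] second_neighbour by metis
    then show ?thesis using at_most_two_neighbours[of v a b]
      by (intro exI[of _ a] exI[of _ b]) auto
  qed
qed (use finite_V V_nonempty A_sub A_refl no_transitive_triangle graph_connected in auto)

end

section \<open>The complex of a digraph and the conclusion\<close>

text \<open>The simplex is the image of a three-element chain. Repeated vertices are allowed, so
  vertices and edges are obtained as special cases.\<close>

lemma transitive_triangle_in_complex: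
  assumes G: "finite_digraph G" "reflexive_digraph G"
    and arcs: "(a, b) \<in> arcs G" "(b, c) \<in> arcs G" "(a, c) \<in> arcs G"
  shows "{a, b, c} \<in> digraph_complex G"
proof -
  define h where "h = (\<lambda>i::nat. if i = 0 then a else if i = 1 then b else c)"
  define r where "r = {(i, j). i \<in> {0, 1, 2 :: nat} \<and> j \<in> {0, 1, 2} \<and> i \<le> j}"
  have V: "a \<in> verts G" "b \<in> verts G" "c \<in> verts G"
    using G(1) arcs by (auto simp: finite_digraph_def)
  then have loops: "(a, a) \<in> arcs G" "(b, b) \<in> arcs G" "(c, c) \<in> arcs G"
    using G(2) by (auto simp: reflexive_digraph_def refl_on_def)
  have "linear_order_on {0, 1, 2} r"
    by (auto simp: r_def linear_order_on_def partial_order_on_def preorder_on_def refl_on_def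
        trans_def antisym_def total_on_def)
  moreover have "h \<in> digraph_hom \<lparr>verts = {0, 1, 2}, arcs = r\<rparr> G"
    using V loops arcs by (auto simp: digraph_hom_def h_def r_def)
  moreover have "{a, b, c} = h ` {0, 1, 2}" by (auto simp: h_def)
  ultimately show ?thesis
    unfolding digraph_complex_def by (intro CollectI exI[of _ h] exI[of _ "{0, 1, 2}"] exI[of _ r]) simp
qed

lemma complexE:
  assumes "S \<in> digraph_complex G"
  shows "S \<subseteq> verts G" "a \<in> S \<Longrightarrow> b \<in> S \<Longrightarrow> a \<noteq> b \<Longrightarrow> adjacent (arcs G) a b"
proof -
  obtain h and B :: "nat set" and r where S: "S = h ` B" "linear_order_on B r"
    "h \<in> digraph_hom \<lparr>verts = B, arcs = r\<rparr> G"
    using assms by (auto simp: digraph_complex_def)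
  then show "S \<subseteq> verts G" by (auto simp: digraph_hom_def)
  assume "a \<in> S" "b \<in> S" "a \<noteq> b"
  then obtain i j where ij: "i \<in> B" "j \<in> B" "a = h i" "b = h j" "i \<noteq> j" using S(1) by auto
  then have "(i, j) \<in> r \<or> (j, i) \<in> r"
    using S(2) by (auto simp: linear_order_on_def total_on_def)
  then show "adjacent (arcs G) a b"
    using S(3) ij \<open>a \<noteq> b\<close> by (auto simp: adjacent_def digraph_hom_def)
qed

lemma triangulated_circle_digraph:
  assumes G: "finite_digraph G" "reflexive_digraph G" and tri: "triangulates G (nsphere 1)"
  shows "circle_digraph (verts G) (arcs G)"
proof -
  define T where "T = {t. (\<forall>v. 0 \<le> t v) \<and> {v. t v \<noteq> 0} \<in> digraph_complex G
      \<and> (\<Sum>v | t v \<noteq> 0. t v) = (1::real)}"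
  have "nsphere 1 homeomorphic_space top_of_set T"
    using tri by (simp only: triangulates_def geometric_realisation_def realisation_topology T_def)
  note facts = homeomorphic_circle_facts[OF this]
  note G' = G[unfolded finite_digraph_def reflexive_digraph_def refl_on_def]
  note triangle = transitive_triangle_in_complex[OF G]
  interpret circle_complex "verts G" "arcs G" "digraph_complex G" T
  proof
    show "{v} \<in> digraph_complex G" if "v \<in> verts G" for v
      using triangle[of v v v] G' that by auto
    show "{a, b} \<in> digraph_complex G" if "adjacent (arcs G) a b" for a b
    proof -
      have "a \<in> verts G" "b \<in> verts G" using that G' by (auto simp: adjacent_def)
      then have "(a, a) \<in> arcs G" "(b, b) \<in> arcs G" using G' by auto
      then show ?thesis using that triangle[of a b b] triangle[of b a a]
        by (auto simp: adjacent_def insert_commute)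
    qed
    show "(v, v) \<in> arcs G" if "v \<in> verts G" for v using G' that by blast
  qed (use G' in blast, use G' in blast, use G' in blast, rule complexE, assumption,
      rule complexE, assumption+, rule triangle, assumption+, rule T_def, rule facts,
      rule facts, assumption, rule facts, assumption+, rule facts)
  show ?thesis by (rule circle_digraph)
qed

theorem theorem4p11:
  fixes G :: "'a digraph"
  assumes "finite_digraph G"
    and "reflexive_digraph G"
    and "triangulates G (nsphere 1)"
  shows "slupecki G"
  unfolding slupecki_def
proof (intro allI impI, elim conjE)
  fix k :: nat and f :: "(nat \<Rightarrow> 'a) \<Rightarrow> 'a"
  assume poly: "polymorphism G k f" and onto: "f ` verts (power_digraph G k) = verts G"
  interpret circle_digraph "verts G" "arcs G"
    using assms by (rule triangulated_circle_digraph)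
  \<comment> \<open>Restricting the argument extends \<open>f\<close> from extensional tuples to all
    functions, as \<open>f_cong\<close> demands.\<close>
  define f' where "f' = (\<lambda>x. f (restrict x {..<k}))"
  interpret circle_polymorphism "verts G" "arcs G" k f'
  proof
    fix x y assume xy: "\<And>i. i < k \<Longrightarrow> (x i, y i) \<in> arcs G"
    then have "x i \<in> verts G \<and> y i \<in> verts G" if "i < k" for i using that A_sub by blast
    then show "(f' x, f' y) \<in> arcs G"
      using poly xy by (auto simp: polymorphism_def digraph_hom_def power_digraph_def f'_def)
  next
    fix x y :: "nat \<Rightarrow> 'a" assume "\<And>i. i < k \<Longrightarrow> x i = y i"
    then show "f' x = f' y" unfolding f'_def by (metis lessThan_iff restrict_ext)
  qed
  have f': "f x = f' x" "\<And>i. i < k \<Longrightarrow> x i \<in> verts G" if "x \<in> verts (power_digraph G k)" for x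
    using that by (auto simp: power_digraph_def f'_def PiE_restrict)
  have "\<exists>x. (\<forall>i<k. x i \<in> verts G) \<and> f' x = v" if "v \<in> verts G" for v
    using that f' unfolding onto[symmetric] by (metis (no_types, lifting) imageE)
  then obtain i g where g: "i < k" "\<And>x. (\<And>l. l < k \<Longrightarrow> x l \<in> verts G) \<Longrightarrow> f' x = g (x i)"
    "\<And>x y. (x, y) \<in> arcs G \<Longrightarrow> (g x, g y) \<in> arcs G"
    using onto_imp_unary by blast
  have "g v \<in> verts G" if "v \<in> verts G" for v using g(3)[of v v] A_refl A_sub that by blast
  then have "g \<in> digraph_hom G G" using g(3) by (auto simp: digraph_hom_def)
  then show "essentially_unary G k f"
    unfolding essentially_unary_def using g(1,2) f' by metis
qed

end
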